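(* Let $\mathcal{H}$ be a complex Hilbert space, let $A_i,B_i,X_i\in\mathcal{B}(\mathcal{H})$ for $1\le i\le n$, and let $f,g$ be non-negative continuous functions on $[0,\infty)$ satisfying $f(t)g(t)=t$ for all $t\ge0$. Then $$\omega^{r}\left(\sum_{i=1}^nA_i^*X_iB_i\right)\le\omega\left(\frac1p\left[\sum_{i=1}^nB_i^*f^2(|X_i|)B_i\right]^{pr/2}+\frac1q\left[\sum_{i=1}^nA_i^*g^2(|X_i^*|)A_i\right]^{qr/2}\right)$$ for all $r\ge1$ and all real $p,q$ with $\frac1p+\frac1q=1$ and $pr,qr\ge2$.
   Context: $\mathcal{B}(\mathcal{H})$ is the algebra of bounded linear operators on $\mathcal{H}$. The numerical radius of a bounded operator $A$ on a complex Hilbert space is $\omega(A)=\sup_{\|x\|=1}|\langle Ax,x\rangle|$, and $\omega^s(A)=(\omega(A))^s$. $|A|=(A^*A)^{1/2}$. For a positive operator $P$, $f^{2}(P)=(f(P))^{2}$ and real powers of $P$ are defined by the continuous functional calculus. *)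

theory Defs
  imports "HOL-Analysis.Analysis" "HOL-Computational_Algebra.Polynomial"
begin

text \<open>Complex Hilbert spaces. The inner product is linear in its first argument; definiteness and
  positivity of the form are contained in \<open>cinner_self\<close> and the norm axioms. The norm, the metric
  and the underlying real vector space are the ones of the library classes.\<close>

class chilbert_space = banach +
  fixes scaleC :: "complex \<Rightarrow> 'a \<Rightarrow> 'a" (infixr \<open>*\<^sub>C\<close> 75)
    and cinner :: "'a \<Rightarrow> 'a \<Rightarrow> complex"
  assumes scaleC_add_right: "c *\<^sub>C (x + y) = c *\<^sub>C x + c *\<^sub>C y"
    and scaleC_add_left: "(c + d) *\<^sub>C x = c *\<^sub>C x + d *\<^sub>C x"
    and scaleC_scaleC: "c *\<^sub>C (d *\<^sub>C x) = (c * d) *\<^sub>C x"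
    and scaleC_of_real: "complex_of_real r *\<^sub>C x = r *\<^sub>R x"
    and cinner_commute: "cinner x y = cnj (cinner y x)"
    and cinner_add_left: "cinner (x + y) z = cinner x z + cinner y z"
    and cinner_scaleC_left: "cinner (c *\<^sub>C x) y = c * cinner x y"
    and cinner_self: "cinner x x = complex_of_real ((norm x)\<^sup>2)"

instantiation complex :: chilbert_space
begin

definition scaleC_complex :: "complex \<Rightarrow> complex \<Rightarrow> complex"
  where "scaleC_complex c x = c * x"

definition cinner_complex :: "complex \<Rightarrow> complex \<Rightarrow> complex"
  where "cinner_complex x y = x * cnj y"

instance
  by standard
    (simp_all add: scaleC_complex_def cinner_complex_def algebra_simps scaleR_conv_of_real
      complex_norm_square[symmetric])

end

text \<open>The algebra \<open>B(H)\<close>, as the complex-linear elements of the library type of bounded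
  real-linear maps, whose norm is the operator norm.\<close>

definition bounded_ops :: "('a::chilbert_space \<Rightarrow>\<^sub>L 'a) set"
  where "bounded_ops = {A. \<forall>c x. blinfun_apply A (c *\<^sub>C x) = c *\<^sub>C blinfun_apply A x}"

definition adj :: "('a::chilbert_space \<Rightarrow>\<^sub>L 'a) \<Rightarrow> ('a \<Rightarrow>\<^sub>L 'a)"
  where "adj A = (THE B. B \<in> bounded_ops \<and>
    (\<forall>x y. cinner (blinfun_apply A x) y = cinner x (blinfun_apply B y)))"

text \<open>On the zero space there is no unit vector; the supremum over the empty set is taken in
  \<open>[0, \<infinity>)\<close>, that is, it is 0 (the real \<open>Sup {}\<close> is unspecified).\<close>

definition numerical_radius :: "('a::chilbert_space \<Rightarrow>\<^sub>L 'a) \<Rightarrow> real"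
  where "numerical_radius A =
    (if \<exists>x::'a. norm x = 1
     then SUP x\<in>{x. norm x = 1}. cmod (cinner (blinfun_apply A x) x)
     else 0)"

definition op_spectrum :: "('a::chilbert_space \<Rightarrow>\<^sub>L 'a) \<Rightarrow> complex set"
  where "op_spectrum A = {l. \<not> (\<exists>B\<in>bounded_ops. \<forall>x.
    blinfun_apply B (blinfun_apply A x - l *\<^sub>C x) = x \<and>
    blinfun_apply A (blinfun_apply B x) - l *\<^sub>C blinfun_apply B x = x)}"

primrec op_power :: "('a::chilbert_space \<Rightarrow>\<^sub>L 'a) \<Rightarrow> nat \<Rightarrow> ('a \<Rightarrow>\<^sub>L 'a)"
  where
    "op_power A 0 = id_blinfun"
  | "op_power A (Suc k) = A o\<^sub>L op_power A k"

definition op_poly :: "real poly \<Rightarrow> ('a::chilbert_space \<Rightarrow>\<^sub>L 'a) \<Rightarrow> ('a \<Rightarrow>\<^sub>L 'a)"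
  where "op_poly h A = (\<Sum>k\<le>degree h. coeff h k *\<^sub>R op_power A k)"

text \<open>The continuous functional calculus of a self-adjoint operator \<open>P\<close>, at a real function that is
  continuous on the spectrum: \<open>f(P)\<close> is the norm limit of \<open>h\<^sub>k(P)\<close> for real polynomials \<open>h\<^sub>k\<close>
  converging to \<open>f\<close> uniformly on the (real) spectrum of \<open>P\<close>. For other \<open>P\<close> or \<open>f\<close> the value is
  not meaningful.\<close>

definition cfc :: "(real \<Rightarrow> real) \<Rightarrow> ('a::chilbert_space \<Rightarrow>\<^sub>L 'a) \<Rightarrow> ('a \<Rightarrow>\<^sub>L 'a)"
  where "cfc f P = (THE T. \<forall>h :: nat \<Rightarrow> real poly.
    uniform_limit {t. complex_of_real t \<in> op_spectrum P} (\<lambda>k. poly (h k)) f sequentially \<longrightarrow>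
    (\<lambda>k. op_poly (h k) P) \<longlonglongrightarrow> T)"

definition op_powr :: "('a::chilbert_space \<Rightarrow>\<^sub>L 'a) \<Rightarrow> real \<Rightarrow> ('a \<Rightarrow>\<^sub>L 'a)"
  where "op_powr P s = cfc (\<lambda>t. t powr s) P"

definition op_abs :: "('a::chilbert_space \<Rightarrow>\<^sub>L 'a) \<Rightarrow> ('a \<Rightarrow>\<^sub>L 'a)"
  where "op_abs A = op_powr (adj A o\<^sub>L A) (1 / 2)"

end

theory Submission
  imports Defs "HOL-Computational_Algebra.Fundamental_Theorem_Algebra"
begin

text \<open>For a unit vector \<open>x\<close> the mixed Schwarz inequality
  \<open>|\<langle>Xa,b\<rangle>| \<le> \<parallel>f(|X|)a\<parallel> \<parallel>g(|X\<^sup>*|)b\<parallel>\<close> and the Cauchy--Schwarz inequality for sums bound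
  \<open>|\<langle>\<Sum> A\<^sub>i\<^sup>*X\<^sub>iB\<^sub>ix,x\<rangle>|\<^sup>r\<close> by \<open>\<langle>Sx,x\<rangle>\<^sup>r\<^sup>/\<^sup>2 \<langle>Tx,x\<rangle>\<^sup>r\<^sup>/\<^sup>2\<close> with
  \<open>S = \<Sum> B\<^sub>i\<^sup>*f\<^sup>2(|X\<^sub>i|)B\<^sub>i\<close> and \<open>T = \<Sum> A\<^sub>i\<^sup>*g\<^sup>2(|X\<^sub>i\<^sup>*|)A\<^sub>i\<close>. Young's inequality splits the product,
  and the Hoelder--McCarthy inequality \<open>\<langle>Px,x\<rangle>\<^sup>s \<le> \<langle>P\<^sup>sx,x\<rangle>\<close> moves the powers inside.

  That the functional calculus is well defined rests on \<open>\<parallel>h(P)\<parallel> \<le> sup |h|\<close> over the real spectrum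
  of a self-adjoint \<open>P\<close>, for real polynomials \<open>h\<close>: the operator \<open>h(P)\<^sup>2 - \<parallel>h(P)\<parallel>\<^sup>2\<close> is not bounded
  below, and neither is then one of its linear factors \<open>P - t\<close>.\<close>

section \<open>Inner products and adjoints\<close>

lemma cinner_add_right: "cinner x (y + z) = cinner x y + cinner x (z :: 'a::chilbert_space)"
  by (metis cinner_add_left cinner_commute complex_cnj_add)

lemma cinner_scaleC_right: "cinner x (c *\<^sub>C y) = cnj c * cinner x (y :: 'a::chilbert_space)"
  by (metis cinner_scaleC_left cinner_commute complex_cnj_mult)

lemma Re_cinner_self: "Re (cinner x x) = (norm (x :: 'a::chilbert_space))\<^sup>2"
  by (simp only: cinner_self Re_complex_of_real)

lemma Re_cinner_commute: "Re (cinner x y) = Re (cinner y (x :: 'a::chilbert_space))"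
  using cinner_commute[of y x] by simp

lemma norm_add_sq: "(norm (x + y :: 'a::chilbert_space))\<^sup>2 = (norm x)\<^sup>2 + 2 * Re (cinner x y) + (norm y)\<^sup>2"
  using Re_cinner_commute[of x y]
  by (simp add: cinner_add_left cinner_add_right flip: Re_cinner_self)

lemma norm_scaleC: "norm (c *\<^sub>C x :: 'a::chilbert_space) = cmod c * norm x"
proof -
  have "cinner (c *\<^sub>C x) (c *\<^sub>C x) = (c * cnj c) * cinner x x"
    by (simp add: cinner_scaleC_left cinner_scaleC_right)
  also have "\<dots> = complex_of_real ((cmod c * norm x)\<^sup>2)"
    by (simp add: cinner_self power_mult_distrib flip: complex_norm_square)
  finally show ?thesis
    unfolding cinner_self of_real_eq_iff
    by (simp only: power2_eq_iff_nonneg[OF norm_ge_zero mult_nonneg_nonneg[OF norm_ge_zero norm_ge_zero]])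
qed

text \<open>Squaring the triangle inequality and expanding with \<open>norm_add_sq\<close> leaves
  exactly this bound, so Cauchy-Schwarz is read off from the norm axioms.\<close>

lemma Re_cinner_le: "Re (cinner x y) \<le> norm x * norm (y :: 'a::chilbert_space)"
  using power_mono[OF norm_triangle_ineq[of x y] norm_ge_zero, of 2]
  by (simp add: norm_add_sq power2_sum)

lemma cmod_cinner_le: "cmod (cinner x y) \<le> norm x * norm (y :: 'a::chilbert_space)"
proof (cases "cinner x y = 0")
  case False
  \<comment> \<open>Rotating \<open>x\<close> by the conjugate phase makes the inner product real
    and non-negative, so the bound for real parts applies.\<close>
  define c where "c = cnj (sgn (cinner x y))"
  have c: "cmod c = 1"
    using False by (simp add: c_def norm_sgn)
  have "cinner (c *\<^sub>C x) y = complex_of_real (cmod (cinner x y))"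
    using False by (simp add: cinner_scaleC_left c_def sgn_eq field_simps complex_norm_square[symmetric] power2_eq_square)
  then have "cmod (cinner x y) = Re (cinner (c *\<^sub>C x) y)"
    by simp
  also have "\<dots> \<le> norm x * norm y"
    using Re_cinner_le[of "c *\<^sub>C x" y] c by (simp add: norm_scaleC)
  finally show ?thesis .
qed simp

interpretation cinner: bounded_bilinear "cinner :: 'a::chilbert_space \<Rightarrow> 'a \<Rightarrow> complex"
proof
  fix x y z :: 'a and r :: real
  show "cinner (x + y) z = cinner x z + cinner y z" by (rule cinner_add_left)
  show "cinner x (y + z) = cinner x y + cinner x z" by (rule cinner_add_right)
  show "cinner (r *\<^sub>R x) y = r *\<^sub>R cinner x y"
    using cinner_scaleC_left[of "of_real r" x y] by (simp add: scaleC_of_real scaleR_conv_of_real)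
  show "cinner x (r *\<^sub>R y) = r *\<^sub>R cinner x y"
    using cinner_scaleC_right[of x "of_real r" y] by (simp add: scaleC_of_real scaleR_conv_of_real)
  show "\<exists>K. \<forall>a b :: 'a. cmod (cinner a b) \<le> norm a * norm b * K"
    by (rule exI[of _ 1]) (simp add: cmod_cinner_le)
qed

lemma cinner_eqI:
  assumes "\<And>x. Re (cinner x y) = Re (cinner x (z :: 'a::chilbert_space))"
  shows "y = z"
proof -
  have "(norm (y - z))\<^sup>2 = Re (cinner (y - z) (y - z))"
    by (simp add: cinner_self)
  also have "\<dots> = Re (cinner (y - z) y) - Re (cinner (y - z) z)"
    by (simp add: cinner.diff_right)
  also have "\<dots> = 0"
    by (subst assms) simp
  finally show ?thesis by simp
qed

text \<open>The vector representing \<open>u\<close> minimises \<open>\<langle>Tx,x\<rangle> - 2u(x)\<close>; coercivity and the parallelogram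
  law make every minimising sequence Cauchy.\<close>

lemma coercive_representation:
  fixes T :: "'a::chilbert_space \<Rightarrow>\<^sub>L 'a" and u :: "'a \<Rightarrow> real"
  assumes u: "bounded_linear u" and c: "c > 0"
    and sym: "\<And>x y. Re (cinner (T x) y) = Re (cinner x (T y))"
    and coer: "\<And>x. c * (norm x)\<^sup>2 \<le> Re (cinner (T x) x)"
  shows "\<exists>y. \<forall>x. u x = Re (cinner (T y) x)"
proof -
  interpret u: bounded_linear u by (rule u)
  define a where "a x = Re (cinner (T x) x)" for x
  define J where "J x = a x - 2 * u x" for x
  have expand: "a (x + t *\<^sub>R y) = a x + 2 * t * Re (cinner (T x) y) + t\<^sup>2 * a y" for x y t
    using sym[of y x] Re_cinner_commute[of "T x" y]
    by (simp add: a_def blinfun.bilinear_simps cinner.add_left cinner.add_right cinner.scaleR_left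
        cinner.scaleR_right algebra_simps power2_eq_square)
  obtain K where K: "\<And>x. norm (u x) \<le> norm x * K"
    using u.bounded by blast
  have bdd: "J x \<ge> - (K\<^sup>2 / c)" for x
  proof -
    \<comment> \<open>Completing the square in \<open>norm x\<close>: the lower bound of
      \<open>J\<close> is the minimum of c s^2 - 2 K s over real s.\<close>
    have "0 \<le> (c * norm x - K)\<^sup>2 / c"
      using c by simp
    also have "\<dots> = c * (norm x)\<^sup>2 - 2 * (norm x * K) + K\<^sup>2 / c"
      using c by (simp add: field_simps power2_eq_square)
    finally show ?thesis
      using coer[of x] K[of x] by (simp add: J_def a_def)
  qed
  then have bb: "bdd_below (range J)"
    by (intro bdd_belowI2) simp
  define m where "m = Inf (range J)"
  have m: "m \<le> J x" for x
    unfolding m_def using bb by (simp add: cInf_lower)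
  have "\<exists>x. J x < m + inverse (Suc k)" for k
    using cInf_lessD[of "range J" "m + inverse (Suc k)"] by (auto simp: m_def)
  then obtain s where s: "\<And>k. J (s k) < m + inverse (Suc k)"
    by metis
  \<comment> \<open>Parallelogram law for the form \<open>a\<close>. The linear terms cancel against
    twice the midpoint value, and \<open>J\<close> is at least \<open>m\<close> at the
    midpoint.\<close>
  have par: "c * (norm (x - y))\<^sup>2 \<le> 2 * (J x + J y - 2 * m)" for x y
  proof -
    have "a (x - y) = 2 * a x + 2 * a y - a (x + y)"
      using expand[of x "-1" y] expand[of x 1 y] by simp
    also have "\<dots> = 2 * (J x + J y - 2 * J ((1/2) *\<^sub>R (x + y)))"
    proof -
      have "a ((1/2) *\<^sub>R (x + y)) = a (x + y) / 4"
        by (simp add: a_def blinfun.scaleR_right cinner.scaleR_left cinner.scaleR_right)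
      moreover have "u ((1/2) *\<^sub>R (x + y)) = (u x + u y) / 2"
        by (simp only: u.scaleR u.add) simp
      ultimately show ?thesis
        by (simp only: J_def) (simp add: field_simps)
    qed
    also have "\<dots> \<le> 2 * (J x + J y - 2 * m)"
      using m by simp
    finally show ?thesis
      using coer[of "x - y"] by (simp add: a_def)
  qed
  have "Cauchy s"
  proof (rule metric_CauchyI)
    fix e :: real assume e: "0 < e"
    obtain N :: nat where N: "inverse (Suc N) < c * e\<^sup>2 / 4"
      using reals_Archimedean[of "c * e\<^sup>2 / 4"] c e by auto
    show "\<exists>M. \<forall>i\<ge>M. \<forall>j\<ge>M. dist (s i) (s j) < e"
    proof (intro exI[of _ N] allI impI)
      fix i j assume ij: "N \<le> i" "N \<le> j"
      then have "inverse (real (Suc i)) \<le> inverse (Suc N)" "inverse (real (Suc j)) \<le> inverse (Suc N)"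
        by (simp_all add: field_simps)
      then have "c * (norm (s i - s j))\<^sup>2 < c * e\<^sup>2"
        using par[of "s i" "s j"] s[of i] s[of j] N
        by (simp only: mult.commute[of c] ring_distribs)
      then show "dist (s i) (s j) < e"
        using c e by (simp add: dist_norm power_less_imp_less_base)
    qed
  qed
  then obtain y where y: "s \<longlonglongrightarrow> y"
    using Cauchy_convergent_iff convergent_def by blast
  have "(\<lambda>k. J (s k)) \<longlonglongrightarrow> J y"
    unfolding J_def a_def
    by (intro tendsto_intros y u.tendsto cinner.tendsto blinfun.tendsto)
  moreover have "(\<lambda>k. m + inverse (real (Suc k))) \<longlonglongrightarrow> m + 0"
    by (intro tendsto_intros LIMSEQ_inverse_real_of_nat)
  ultimately have Jy: "J y \<le> m"
    using s by (intro LIMSEQ_le[where X = "\<lambda>k. J (s k)"]) (auto intro: less_imp_le)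
  have "u x = Re (cinner (T y) x)" for x
  proof -
    define d where "d = Re (cinner (T y) x) - u x"
    \<comment> \<open>First variation: perturbing the minimiser \<open>y\<close> in direction
      \<open>x\<close> cannot decrease \<open>J\<close>.\<close>
    have q: "0 \<le> 2 * t * d + t\<^sup>2 * a x" for t
      using m[of "y + t *\<^sub>R x"] Jy
      by (simp add: J_def expand u.add u.scaleR d_def algebra_simps)
    have ax: "0 \<le> a x"
      using coer[of x] c by (simp add: a_def) (meson mult_nonneg_nonneg order_trans less_imp_le zero_le_power2)
    \<comment> \<open>The optimal step would be \<open>- d / a x\<close>; the added 1 keeps the
      denominator positive when \<open>a x = 0\<close>.\<close>
    have "0 \<le> 2 * (- d / (a x + 1)) * d + (- d / (a x + 1))\<^sup>2 * a x"
      by (rule q)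
    also have "\<dots> = - d\<^sup>2 * (a x + 2) / (a x + 1)\<^sup>2"
      using ax by (simp add: field_simps power2_eq_square add_nonneg_eq_0_iff)
    finally have "d\<^sup>2 * (a x + 2) / (a x + 1)\<^sup>2 \<le> 0"
      by simp
    then have "d = 0"
      using ax by (simp add: divide_le_0_iff mult_le_0_iff)
    then show ?thesis by (simp add: d_def)
  qed
  then show ?thesis by blast
qed

section \<open>Adjoints and the algebra of bounded operators\<close>

lemma bounded_opsD: "A \<in> bounded_ops \<Longrightarrow> A (c *\<^sub>C x) = c *\<^sub>C A x"
  by (simp add: bounded_ops_def)

lemma adj_unique:
  fixes A B C :: "'a::chilbert_space \<Rightarrow>\<^sub>L 'a"
  assumes "\<And>x y. cinner (A x) y = cinner x (B y)" "\<And>x y. cinner (A x) y = cinner x (C y)"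
  shows "B = C"
  by (rule blinfun_eqI, rule cinner_eqI) (metis assms)

text \<open>Riesz representation, which is \<open>coercive_representation\<close> for the identity
  operator with constant 1, applied to the functionals sending x to Re of
  \<open>cinner (A x) y\<close>.\<close>

lemma adjoint_exists:
  fixes A :: "'a::chilbert_space \<Rightarrow>\<^sub>L 'a"
  assumes A: "A \<in> bounded_ops"
  shows "\<exists>B\<in>bounded_ops. \<forall>x y. cinner (A x) y = cinner x (B y)"
proof -
  have "\<exists>z. \<forall>x. Re (cinner (A x) y) = Re (cinner x z)" for y
  proof -
    have "bounded_linear (\<lambda>x. Re (cinner (A x) y))"
      by (intro bounded_linear_compose[OF bounded_linear_Re] bounded_linear_compose[OF cinner.bounded_linear_left]
          blinfun.bounded_linear_right)
    from coercive_representation[OF this, of 1 id_blinfun]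
    show ?thesis
      by (auto simp: Re_cinner_self) (metis Re_cinner_commute)
  qed
  then obtain B where B: "\<And>x y. Re (cinner (A x) y) = Re (cinner x (B y))"
    by metis
  have adj: "cinner (A x) y = cinner x (B y)" for x y
  proof (rule complex_eqI)
    \<comment> \<open>Complex linearity of \<open>A\<close> recovers the imaginary part from the
      real part at \<open>\<i> *\<^sub>C x\<close>.\<close>
    show "Im (cinner (A x) y) = Im (cinner x (B y))"
      using B[of "\<i> *\<^sub>C x" y] by (simp add: bounded_opsD[OF A] cinner_scaleC_left)
  qed (rule B)
  have lin: "B (x + y) = B x + B y" "B (c *\<^sub>C x) = c *\<^sub>C B x" for x y c
    by (rule cinner_eqI; simp add: cinner_add_right cinner_scaleC_right flip: adj)+
  have "bounded_linear B"
  proof (rule bounded_linear_intro[where K = "norm A"])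
    show "B (r *\<^sub>R x) = r *\<^sub>R B x" for r x
      using lin(2)[of "of_real r" x] by (simp add: scaleC_of_real)
    show "norm (B y) \<le> norm y * norm A" for y
    proof (cases "B y = 0")
      case False
      have "norm (B y) * norm (B y) = Re (cinner (A (B y)) y)"
        using B[of "B y" y] by (simp add: Re_cinner_self power2_eq_square)
      also have "\<dots> \<le> norm (A (B y)) * norm y"
        by (rule Re_cinner_le)
      also have "\<dots> \<le> norm (B y) * (norm y * norm A)"
        using mult_right_mono[OF norm_blinfun[of A "B y"] norm_ge_zero[of y]] by (simp add: mult_ac)
      finally show ?thesis
        using False by simp
    qed simp
  qed (rule lin)
  then have "blinfun_apply (Blinfun B) = B"
    by (rule bounded_linear_Blinfun_apply)
  with adj lin(2) show ?thesis
    by (intro bexI[of _ "Blinfun B"]) (auto simp: bounded_ops_def)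
qed

lemma
  fixes A :: "'a::chilbert_space \<Rightarrow>\<^sub>L 'a"
  assumes "A \<in> bounded_ops"
  shows adj_bounded_ops: "adj A \<in> bounded_ops"
    and cinner_adj: "cinner (A x) y = cinner x (adj A y)"
proof -
  obtain B where B: "B \<in> bounded_ops" "\<And>x y. cinner (A x) y = cinner x (B y)"
    using adjoint_exists[OF assms] by blast
  have "adj A = B"
    unfolding adj_def
  proof (rule the_equality)
    show "C = B" if "C \<in> bounded_ops \<and> (\<forall>x y. cinner (A x) y = cinner x (C y))" for C
      using adj_unique[of A C B] B that by blast
  qed (use B in blast)
  with B show "adj A \<in> bounded_ops" "cinner (A x) y = cinner x (adj A y)"
    by auto
qed

lemma adj_adj:
  fixes A :: "'a::chilbert_space \<Rightarrow>\<^sub>L 'a"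
  assumes "A \<in> bounded_ops"
  shows "adj (adj A) = A"
proof (rule adj_unique)
  show "cinner (adj A x) y = cinner x (adj (adj A) y)" for x y
    by (intro cinner_adj adj_bounded_ops assms)
  show "cinner (adj A x) y = cinner x (A y)" for x y
    using cinner_adj[OF assms, of y x] by (metis cinner_commute)
qed

lemma bounded_ops_id [intro, simp]: "id_blinfun \<in> bounded_ops"
  by (simp add: bounded_ops_def)

lemma bounded_ops_compose [intro]: "A \<in> bounded_ops \<Longrightarrow> B \<in> bounded_ops \<Longrightarrow> A o\<^sub>L B \<in> bounded_ops"
  by (simp add: bounded_ops_def)

lemma scaleC_scaleR_commute: "c *\<^sub>C (r *\<^sub>R x) = r *\<^sub>R (c *\<^sub>C (x :: 'a::chilbert_space))"
  by (simp add: scaleC_scaleC mult.commute flip: scaleC_of_real)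

lemma scaleC_zero_right [simp]: "c *\<^sub>C 0 = (0 :: 'a::chilbert_space)"
  using scaleC_add_right[of c 0 "0::'a"] by simp

lemma bounded_ops_scaleR [intro]: "A \<in> bounded_ops \<Longrightarrow> r *\<^sub>R A \<in> bounded_ops"
  by (simp add: bounded_ops_def blinfun.scaleR_left scaleC_scaleR_commute)

lemma bounded_ops_add [intro]: "A \<in> bounded_ops \<Longrightarrow> B \<in> bounded_ops \<Longrightarrow> A + B \<in> bounded_ops"
  by (simp add: bounded_ops_def blinfun.add_left scaleC_add_right)

lemma bounded_ops_zero [intro, simp]: "0 \<in> bounded_ops"
  by (simp add: bounded_ops_def)

lemma bounded_linear_scaleC: "bounded_linear (\<lambda>x :: 'a::chilbert_space. c *\<^sub>C x)"
  by (rule bounded_linear_intro[where K = "cmod c"])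
     (simp_all add: scaleC_add_right scaleC_scaleR_commute norm_scaleC)

lemma bounded_ops_limit:
  fixes T :: "nat \<Rightarrow> 'a::chilbert_space \<Rightarrow>\<^sub>L 'a"
  assumes lim: "T \<longlonglongrightarrow> S" and T: "\<And>k. T k \<in> bounded_ops"
  shows "S \<in> bounded_ops"
  unfolding bounded_ops_def
proof (intro CollectI allI)
  fix c x
  have "(\<lambda>k. T k (c *\<^sub>C x)) \<longlonglongrightarrow> S (c *\<^sub>C x)" "(\<lambda>k. c *\<^sub>C T k x) \<longlonglongrightarrow> c *\<^sub>C S x"
    by (intro tendsto_intros blinfun.tendsto bounded_linear.tendsto[OF bounded_linear_scaleC] lim)+
  then show "S (c *\<^sub>C x) = c *\<^sub>C S x"
    using LIMSEQ_unique by (simp add: bounded_opsD[OF T])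
qed

section \<open>Self-adjoint and positive operators, their inverses and their real spectrum\<close>

definition selfadj :: "('a::chilbert_space \<Rightarrow>\<^sub>L 'a) \<Rightarrow> bool"
  where "selfadj P \<longleftrightarrow> P \<in> bounded_ops \<and> (\<forall>x y. cinner (P x) y = cinner x (P y))"

text \<open>Symmetry already makes the diagonal of the form real, so positivity can be stated with
  \<open>Re\<close>.\<close>

definition posop :: "('a::chilbert_space \<Rightarrow>\<^sub>L 'a) \<Rightarrow> bool"
  where "posop P \<longleftrightarrow> selfadj P \<and> (\<forall>x. 0 \<le> Re (cinner (P x) x))"

lemma selfadj_bounded_ops: "selfadj P \<Longrightarrow> P \<in> bounded_ops"
  by (simp add: selfadj_def)

lemma selfadjD: "selfadj P \<Longrightarrow> cinner (P x) y = cinner x (P y)"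
  by (simp add: selfadj_def)

lemma posop_selfadj: "posop P \<Longrightarrow> selfadj P"
  by (simp add: posop_def)

lemma posopD: "posop P \<Longrightarrow> 0 \<le> Re (cinner (P x) x)"
  by (simp add: posop_def)

lemma selfadj_id [simp]: "selfadj id_blinfun"
  by (simp add: selfadj_def)

lemma selfadj_zero [simp]: "selfadj 0"
  by (simp add: selfadj_def cinner.zero_left cinner.zero_right)

lemma selfadj_add: "selfadj P \<Longrightarrow> selfadj Q \<Longrightarrow> selfadj (P + Q)"
  by (auto simp: selfadj_def blinfun.add_left cinner_add_left cinner_add_right)

lemma selfadj_scaleR: "selfadj P \<Longrightarrow> selfadj (r *\<^sub>R P)"
  by (auto simp: selfadj_def blinfun.scaleR_left cinner.scaleR_left cinner.scaleR_right)

lemma selfadj_sum: "(\<And>i. i \<in> I \<Longrightarrow> selfadj (P i)) \<Longrightarrow> selfadj (sum P I)"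
  by (induction I rule: infinite_finite_induct) (auto intro: selfadj_add)

lemma selfadj_limit:
  fixes T :: "nat \<Rightarrow> 'a::chilbert_space \<Rightarrow>\<^sub>L 'a"
  assumes lim: "T \<longlonglongrightarrow> S" and T: "\<And>k. selfadj (T k)"
  shows "selfadj S"
  unfolding selfadj_def
proof (intro conjI allI)
  show "S \<in> bounded_ops"
    using bounded_ops_limit[OF lim] T by (simp add: selfadj_def)
  fix x y
  have "(\<lambda>k. cinner (T k x) y) \<longlonglongrightarrow> cinner (S x) y" "(\<lambda>k. cinner x (T k y)) \<longlonglongrightarrow> cinner x (S y)"
    by (intro cinner.tendsto tendsto_intros blinfun.tendsto lim)+
  then show "cinner (S x) y = cinner x (S y)"
    using LIMSEQ_unique by (simp add: selfadjD[OF T])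
qed

text \<open>The lower bound gives injectivity and also bounds the set-theoretic inverse by
  \<open>1 / c\<close>, so the open mapping theorem is avoided.\<close>

lemma bounded_below_inverse_bounded:
  fixes T :: "'a::real_normed_vector \<Rightarrow>\<^sub>L 'a"
  assumes c: "c > 0" and bb: "\<And>x. c * norm x \<le> norm (T x)" and surj: "surj (blinfun_apply T)"
  shows "\<exists>B. \<forall>x. blinfun_apply B (T x) = x \<and> T (blinfun_apply B x) = x"
proof -
  obtain B where B: "\<And>y. T (B y) = y"
    using surj by (metis surjD)
  have inj: "x = y" if "T x = T y" for x y
    using bb[of "x - y"] that c by (simp add: blinfun.diff_right mult_le_0_iff)
  have "bounded_linear B"
  proof (rule bounded_linear_intro[where K = "1 / c"])
    show "B (x + y) = B x + B y" "B (r *\<^sub>R x) = r *\<^sub>R B x" for x y r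
      by (rule inj; simp add: B blinfun.add_right blinfun.scaleR_right)+
    show "norm (B y) \<le> norm y * (1 / c)" for y
      using bb[of "B y"] c by (simp add: B field_simps)
  qed
  then have "blinfun_apply (Blinfun B) = B"
    by (rule bounded_linear_Blinfun_apply)
  then show ?thesis
    by (intro exI[of _ "Blinfun B"]) (metis B inj)
qed

text \<open>The argument of Lax and Milgram: representing the functional Re of
  \<open>cinner z\<close> through the form of \<open>T\<close> yields a preimage of
  \<open>z\<close>.\<close>

lemma coercive_surj:
  fixes T :: "'a::chilbert_space \<Rightarrow>\<^sub>L 'a"
  assumes c: "c > 0" and T: "selfadj T" and coer: "\<And>x. c * (norm x)\<^sup>2 \<le> Re (cinner (T x) x)"
  shows "surj (blinfun_apply T)"
  unfolding surj_def
proof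
  fix z :: 'a
  have "bounded_linear (\<lambda>x. Re (cinner z x))"
    by (intro bounded_linear_compose[OF bounded_linear_Re] cinner.bounded_linear_right)
  from coercive_representation[OF this c _ coer] obtain y where "\<And>x. Re (cinner z x) = Re (cinner (T y) x)"
    using selfadjD[OF T] by metis
  then have "z = T y"
    by (intro cinner_eqI) (metis Re_cinner_commute)
  then show "\<exists>x. z = T x" by blast
qed

lemma coercive_bounded_below:
  fixes T :: "'a::chilbert_space \<Rightarrow>\<^sub>L 'a"
  assumes coer: "\<And>x. c * (norm x)\<^sup>2 \<le> Re (cinner (T x) x)"
  shows "c * norm x \<le> norm (T x)"
proof (cases "x = 0")
  case False
  have "(c * norm x) * norm x \<le> norm (T x) * norm x"
    using coer[of x] Re_cinner_le[of "T x" x] by (simp add: power2_eq_square mult_ac)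
  with False show ?thesis by simp
qed (simp add: blinfun.zero_right)

text \<open>Exactly the set on which \<open>cfc\<close> demands uniform convergence; that definition
  is folded to this name later.\<close>

definition real_spectrum :: "('a::chilbert_space \<Rightarrow>\<^sub>L 'a) \<Rightarrow> real set"
  where "real_spectrum P = {t. complex_of_real t \<in> op_spectrum P}"

text \<open>A bounded left inverse \<open>B\<close> would give the lower bound
  \<open>1 / (norm B + 1)\<close>; the added 1 covers \<open>norm B = 0\<close>.\<close>

lemma not_bounded_below_real_spectrum:
  fixes P :: "'a::chilbert_space \<Rightarrow>\<^sub>L 'a"
  assumes "\<not> (\<exists>c>0. \<forall>x. c * norm x \<le> norm (P x - t *\<^sub>R x))"
  shows "t \<in> real_spectrum P"
proof (rule ccontr)
  assume "t \<notin> real_spectrum P"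
  then obtain B where B: "\<And>x. blinfun_apply B (P x - t *\<^sub>R x) = x"
    by (auto simp: real_spectrum_def op_spectrum_def scaleC_of_real)
  have "1 / (norm B + 1) * norm x \<le> norm (P x - t *\<^sub>R x)" for x
  proof -
    have "norm x \<le> norm B * norm (P x - t *\<^sub>R x)"
      using norm_blinfun[of B "P x - t *\<^sub>R x"] by (simp add: B)
    also have "\<dots> \<le> (norm B + 1) * norm (P x - t *\<^sub>R x)"
      by (intro mult_right_mono) auto
    finally have "norm x / (norm B + 1) \<le> norm (P x - t *\<^sub>R x)"
      by (subst pos_divide_le_eq) (simp_all add: add_nonneg_pos mult.commute)
    then show ?thesis by simp
  qed
  moreover have "1 / (norm B + 1) > 0"
    by (simp add: add_nonneg_pos)
  ultimately show False
    using assms by blast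
qed

text \<open>The operator s (P - t) is coercive, hence has a bounded inverse, and \<open>s\<close>
  times that inverse inverts P - t. The sign of \<open>s\<close> lets one statement treat points
  below and above the spectrum.\<close>

lemma coercive_not_real_spectrum:
  fixes P :: "'a::chilbert_space \<Rightarrow>\<^sub>L 'a"
  assumes c: "c > 0" and P: "selfadj P" and s: "s \<noteq> 0"
    and coer: "\<And>x. c * (norm x)\<^sup>2 \<le> s * (Re (cinner (P x) x) - t * (norm x)\<^sup>2)"
  shows "t \<notin> real_spectrum P"
proof -
  define T where "T = s *\<^sub>R (P + (- t) *\<^sub>R id_blinfun)"
  have T: "T x = s *\<^sub>R (P x - t *\<^sub>R x)" for x
    by (simp add: T_def blinfun.bilinear_simps)
  have sa: "selfadj T"
    unfolding T_def by (intro selfadj_scaleR selfadj_add P selfadj_id)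
  have co: "c * (norm x)\<^sup>2 \<le> Re (cinner (T x) x)" for x
    using coer[of x] by (simp add: T cinner.diff_left cinner.scaleR_left Re_cinner_self)
  obtain B where B: "\<And>x. blinfun_apply B (T x) = x" "\<And>x. T (blinfun_apply B x) = x"
    using bounded_below_inverse_bounded[OF c coercive_bounded_below coercive_surj, OF co c sa co] by auto
  have "B \<in> bounded_ops"
    unfolding bounded_ops_def
    by (intro CollectI allI) (metis B bounded_opsD[OF selfadj_bounded_ops[OF sa]])
  then have "s *\<^sub>R B \<in> bounded_ops"
    by blast
  moreover have "(s *\<^sub>R B) (P x - t *\<^sub>R x) = x" "P ((s *\<^sub>R B) x) - t *\<^sub>R (s *\<^sub>R B) x = x" for x
    using B[of x] by (simp_all add: T blinfun.bilinear_simps algebra_simps)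
  ultimately show ?thesis
    unfolding real_spectrum_def op_spectrum_def mem_Collect_eq scaleC_of_real not_not by blast
qed

text \<open>For t < 0 the operator P - t is coercive with constant -t; for t > \<open>norm P\<close>
  the operator t - P is coercive with constant t - \<open>norm P\<close>.\<close>

lemma real_spectrum_subset:
  fixes P :: "'a::chilbert_space \<Rightarrow>\<^sub>L 'a"
  assumes P: "posop P"
  shows "real_spectrum P \<subseteq> {0..norm P}"
proof
  fix t assume t: "t \<in> real_spectrum P"
  have "0 \<le> t"
  proof (rule ccontr)
    assume "\<not> 0 \<le> t"
    then show False
      using coercive_not_real_spectrum[OF _ posop_selfadj[OF P], of "- t" 1 t] posopD[OF P] t by auto
  qed
  moreover have "t \<le> norm P"
  proof (rule ccontr)
    assume "\<not> t \<le> norm P"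
    moreover have "Re (cinner (P x) x) \<le> norm P * (norm x)\<^sup>2" for x
      using order_trans[OF Re_cinner_le[of "P x" x] mult_right_mono[OF norm_blinfun norm_ge_zero]]
      by (simp add: power2_eq_square mult_ac)
    ultimately show False
      using coercive_not_real_spectrum[OF _ posop_selfadj[OF P], of "t - norm P" "-1" t] t
      by (auto simp: algebra_simps)
  qed
  ultimately show "t \<in> {0..norm P}" by simp
qed

section \<open>Polynomials of a self-adjoint operator\<close>

lemma op_poly_eq:
  assumes "degree h \<le> N"
  shows "op_poly h A = (\<Sum>k\<le>N. coeff h k *\<^sub>R op_power A k)"
  unfolding op_poly_def using assms
  by (intro sum.mono_neutral_left) (auto simp: coeff_eq_0)

lemmas blinfun_compose_simps =
  bounded_bilinear.add_left[OF bounded_bilinear_blinfun_compose]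
  bounded_bilinear.add_right[OF bounded_bilinear_blinfun_compose]
  bounded_bilinear.scaleR_left[OF bounded_bilinear_blinfun_compose]
  bounded_bilinear.scaleR_right[OF bounded_bilinear_blinfun_compose]
  bounded_bilinear.zero_left[OF bounded_bilinear_blinfun_compose]
  bounded_bilinear.zero_right[OF bounded_bilinear_blinfun_compose]
  bounded_bilinear.sum_right[OF bounded_bilinear_blinfun_compose]

lemma blinfun_compose_assoc: "(A o\<^sub>L B) o\<^sub>L C = A o\<^sub>L (B o\<^sub>L C)"
  by (rule blinfun_eqI) simp

lemma blinfun_compose_id: "A o\<^sub>L id_blinfun = A" "id_blinfun o\<^sub>L A = A"
  by (rule blinfun_eqI; simp)+

text \<open>Horner's recursion, which makes the algebraic rules below provable by induction on the
  polynomial.\<close>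

lemma op_poly_pCons: "op_poly (pCons a h) A = a *\<^sub>R id_blinfun + (A o\<^sub>L op_poly h A)"
proof -
  have "op_poly (pCons a h) A = (\<Sum>k\<le>Suc (degree h). coeff (pCons a h) k *\<^sub>R op_power A k)"
    by (rule op_poly_eq) (rule degree_pCons_le)
  also have "\<dots> = a *\<^sub>R id_blinfun + (A o\<^sub>L op_poly h A)"
    by (simp add: sum.atMost_Suc_shift op_poly_def blinfun_compose_simps del: sum.atMost_Suc)
  finally show ?thesis .
qed

lemma op_poly_0 [simp]: "op_poly 0 A = 0"
  by (simp add: op_poly_def)

lemma op_poly_add: "op_poly (h + k) A = op_poly h A + op_poly k A"
  by (induction h k rule: poly_induct2)
     (simp_all add: op_poly_pCons blinfun_compose_simps scaleR_add_left)

lemma op_poly_smult: "op_poly (smult c h) A = c *\<^sub>R op_poly h A"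
  by (induction h) (simp_all add: op_poly_pCons blinfun_compose_simps scaleR_add_right)

lemma op_poly_diff: "op_poly (h - k) A = op_poly h A - op_poly k A"
  using op_poly_add[of "h - k" k A] by simp

lemma op_poly_mult: "op_poly (h * k) A = op_poly h A o\<^sub>L op_poly k A"
  by (induction h)
     (simp_all add: op_poly_pCons op_poly_add op_poly_smult blinfun_compose_simps
       blinfun_compose_assoc blinfun_compose_id)

lemma op_poly_linear: "op_poly [:a, b:] A = a *\<^sub>R id_blinfun + b *\<^sub>R A"
  by (simp add: op_poly_pCons blinfun_compose_simps blinfun_compose_id)

text \<open>Taking all three operators equal gives that \<open>P\<close> commutes with h(P); the
  general form carries \<open>X\<close> across from functions of \<open>op_abs X\<close> to
  functions of \<open>op_abs (adj X)\<close>.\<close>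

lemma op_poly_intertwine:
  assumes "X o\<^sub>L P = Q o\<^sub>L X"
  shows "X o\<^sub>L op_poly h P = op_poly h Q o\<^sub>L X"
proof (induction h)
  case (pCons a h)
  have "X o\<^sub>L (P o\<^sub>L op_poly h P) = Q o\<^sub>L (X o\<^sub>L op_poly h P)"
    by (metis assms blinfun_compose_assoc)
  then show ?case
    by (simp add: op_poly_pCons blinfun_compose_simps blinfun_compose_id blinfun_compose_assoc pCons.IH)
qed (simp add: blinfun_compose_simps)

lemma selfadj_op_poly:
  assumes P: "selfadj P"
  shows "selfadj (op_poly h P)"
proof (induction h)
  case (pCons a h)
  \<comment> \<open>A product of self-adjoint operators is self-adjoint once the factors
    commute.\<close>
  have "op_poly h P o\<^sub>L P = P o\<^sub>L op_poly h P"
    using op_poly_intertwine[of P P P h] by simp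
  then have "P (op_poly h P x) = op_poly h P (P x)" for x
    by (metis blinfun_apply_blinfun_compose)
  then have "selfadj (P o\<^sub>L op_poly h P)"
    using P pCons.IH by (auto simp: selfadj_def)
  then show ?case
    unfolding op_poly_pCons by (intro selfadj_add selfadj_scaleR selfadj_id)
qed simp

text \<open>Weaker than invertibility but preserved by products, which suits an argument that
  factors a polynomial.\<close>

definition bounded_below :: "('a::real_normed_vector \<Rightarrow>\<^sub>L 'a) \<Rightarrow> bool"
  where "bounded_below T \<longleftrightarrow> (\<exists>c>0. \<forall>x. c * norm x \<le> norm (T x))"

lemma bounded_below_compose:
  assumes "bounded_below S" "bounded_below T"
  shows "bounded_below (S o\<^sub>L T)"
proof -
  obtain c d where cd: "c > 0" "d > 0" "\<And>x. c * norm x \<le> norm (S x)" "\<And>x. d * norm x \<le> norm (T x)"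
    using assms unfolding bounded_below_def by blast
  have "c * d * norm x \<le> norm ((S o\<^sub>L T) x)" for x
    using order_trans[OF mult_left_mono[OF cd(4), of c x] cd(3)[of "T x"]] cd(1) by (simp add: mult.assoc)
  then show ?thesis
    unfolding bounded_below_def using cd(1,2) by (intro exI[of _ "c * d"]) simp
qed

text \<open>A real polynomial splits into real linear factors and quadratics \<open>(t - a)\<^sup>2 + b\<^sup>2\<close>; the latter
  always give a coercive operator.\<close>

lemma bounded_below_op_poly:
  fixes P :: "'a::chilbert_space \<Rightarrow>\<^sub>L 'a"
  assumes P: "selfadj P" and u: "u \<noteq> 0"
    and roots: "\<And>t. t \<in> real_spectrum P \<Longrightarrow> poly u t \<noteq> 0"
  shows "bounded_below (op_poly u P)"
  using u roots
proof (induction "degree u" arbitrary: u rule: less_induct)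
  case less
  \<comment> \<open>Complex coefficients give access to the fundamental theorem of algebra.\<close>
  define hom where "hom = map_poly complex_of_real"
  have hom_mult: "hom (p * q) = hom p * hom q" and hom_add: "hom (p + q) = hom p + hom q" for p q
    by (rule poly_eqI; simp add: hom_def coeff_map_poly coeff_mult)+
  have hom_real: "poly (hom p) (of_real t) = of_real (poly p t)" for p t
    by (induction p) (simp_all add: hom_def map_poly_pCons)
  show ?case
  proof (cases "degree u = 0")
    case True
    then obtain c where c: "u = [:c:]"
      by (rule degree_eq_zeroE)
    then have "op_poly u P x = c *\<^sub>R x" for x
      by (simp add: op_poly_pCons blinfun.bilinear_simps)
    then show ?thesis
      using c less.prems(1) unfolding bounded_below_def by (intro exI[of _ "\<bar>c\<bar>"]) simp
  next
    case False
    then have "degree (hom u) \<noteq> 0"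
      by (simp add: hom_def degree_map_poly)
    then obtain z where z: "poly (hom u) z = 0"
      using fundamental_theorem_of_algebra constant_degree by metis
    define a b where "a = Re z" and "b = Im z"
    \<comment> \<open>One factor \<open>w\<close> is split off, linear for a real root and quadratic
      otherwise; the induction hypothesis takes care of \<open>v\<close>.\<close>
    have "\<exists>w v. u = w * v \<and> degree w \<noteq> 0 \<and> bounded_below (op_poly w P)"
    proof (cases "b = 0")
      case True
      then have "poly u a = 0"
        using z hom_real[of u a] by (metis a_def b_def complex_is_Real_iff of_real_Re of_real_eq_0_iff)
      then obtain v where v: "u = [:-a, 1:] * v"
        by (auto simp: poly_eq_0_iff_dvd dvd_def)
      have "a \<notin> real_spectrum P"
        using \<open>poly u a = 0\<close> less.prems(2) by blast
      then have "bounded_below (op_poly [:-a, 1:] P)"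
        using not_bounded_below_real_spectrum[of P a]
        by (force simp: bounded_below_def op_poly_linear blinfun.bilinear_simps)
      with v show ?thesis
        by (intro exI[of _ "[:-a, 1:]"] exI[of _ v]) auto
    next
      case False
      \<comment> \<open>The product of t - z and t - \<open>cnj z\<close>, that is (t - a)^2 +
        b^2.\<close>
      define w where "w = [:a\<^sup>2 + b\<^sup>2, - 2 * a, 1:]"
      have w0: "poly (hom w) z = 0"
        by (simp add: hom_def w_def map_poly_pCons complex_eq_iff a_def b_def power2_eq_square algebra_simps)
      have dw: "degree w = 2"
        by (simp add: w_def)
      \<comment> \<open>The remainder is real, of degree below 2, and vanishes at the non-real
        \<open>z\<close>, so it must be zero.\<close>
      define m where "m = u mod w"
      have "poly (hom m) z = 0"
      proof -
        have "u = w * (u div w) + m"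
          by (simp add: m_def)
        then have "poly (hom u) z = poly (hom w) z * poly (hom (u div w)) z + poly (hom m) z"
          by (metis hom_add hom_mult poly_add poly_mult)
        with z w0 show ?thesis by simp
      qed
      moreover obtain c d where cd: "m = [:c, d:]"
      proof -
        have "degree m < 2"
          using degree_mod_less[of w u] dw by (auto simp: m_def w_def)
        then have "m = [:coeff m 0, coeff m 1:]"
          by (intro poly_eqI) (auto simp: coeff_pCons coeff_eq_0 split: nat.split)
        then show ?thesis by (rule that)
      qed
      ultimately have "d = 0" "c = 0"
        using False by (auto simp: hom_def map_poly_pCons complex_eq_iff b_def)
      then have "w dvd u"
        using cd by (simp add: m_def mod_eq_0_iff_dvd)
      moreover have "bounded_below (op_poly w P)"
      proof -
        \<comment> \<open>The form of w(P) at \<open>x\<close> is the squared norm of Px - ax plus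
          b^2 times that of \<open>x\<close>.\<close>
        have "b\<^sup>2 * (norm x)\<^sup>2 \<le> Re (cinner (op_poly w P x) x)" for x
        proof -
          have "op_poly w P x = (a\<^sup>2 + b\<^sup>2) *\<^sub>R x + P (P x - (2 * a) *\<^sub>R x)"
            by (simp add: w_def op_poly_pCons blinfun.bilinear_simps)
          then have "Re (cinner (op_poly w P x) x)
              = (a\<^sup>2 + b\<^sup>2) * (norm x)\<^sup>2 + (norm (P x))\<^sup>2 - 2 * a * Re (cinner (P x) x)"
            by (simp add: blinfun.bilinear_simps cinner.diff_left cinner.add_left cinner.scaleR_left
                Re_cinner_self) (simp add: selfadjD[OF P, of "P x"] Re_cinner_self)
          moreover have "0 \<le> (norm (P x + (- a) *\<^sub>R x))\<^sup>2"
            by simp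
          then have "0 \<le> (norm (P x))\<^sup>2 - 2 * a * Re (cinner (P x) x) + a\<^sup>2 * (norm x)\<^sup>2"
            unfolding norm_add_sq by (simp add: cinner.scaleR_right cinner.minus_right power_mult_distrib)
          ultimately show ?thesis
            by (simp add: algebra_simps)
        qed
        then have "b\<^sup>2 * norm x \<le> norm (op_poly w P x)" for x
          by (rule coercive_bounded_below)
        then show ?thesis
          unfolding bounded_below_def using False by (intro exI[of _ "b\<^sup>2"]) simp
      qed
      ultimately show ?thesis
        using dw by (auto simp: dvd_def)
    qed
    then obtain w v where wv: "u = w * v" "degree w \<noteq> 0" "bounded_below (op_poly w P)"
      by blast
    have "v \<noteq> 0" "w \<noteq> 0"
      using wv(1) less.prems(1) by auto
    then have "degree v < degree u"
      using wv(1,2) by (simp add: degree_mult_eq)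
    then have "bounded_below (op_poly v P)"
      using less.hyps[of v] less.prems wv(1) by auto
    then show ?thesis
      using wv(1,3) by (simp add: op_poly_mult bounded_below_compose)
  qed
qed

text \<open>\<open>\<parallel>T\<parallel>\<^sup>2\<close> is an approximate eigenvalue of \<open>T\<^sup>2\<close>.\<close>

lemma not_bounded_below_norm:
  fixes T :: "'a::chilbert_space \<Rightarrow>\<^sub>L 'a"
  assumes T: "selfadj T" and x0: "x0 \<noteq> (0 :: 'a)"
  shows "\<not> bounded_below ((T o\<^sub>L T) - (norm T)\<^sup>2 *\<^sub>R id_blinfun)"
proof
  define M where "M = norm T"
  assume "bounded_below ((T o\<^sub>L T) - (norm T)\<^sup>2 *\<^sub>R id_blinfun)"
  then obtain c where c: "c > 0" "\<And>x. c * norm x \<le> norm (T (T x) - M\<^sup>2 *\<^sub>R x)"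
    by (auto simp: bounded_below_def blinfun.bilinear_simps M_def)
  show False
  proof (cases "M = 0")
    case True
    then have "T = 0" by (simp add: M_def)
    then show False
      using c x0 True by (simp add: mult_le_0_iff)
  next
    case False
    then have M: "M > 0" by (simp add: M_def)
    \<comment> \<open>Square the assumed lower bound, expand, and estimate the norm of T(Tx) by
      \<open>M\<close> times that of Tx.\<close>
    have key: "c\<^sup>2 * (norm x)\<^sup>2 \<le> M\<^sup>2 * (M\<^sup>2 * (norm x)\<^sup>2 - (norm (T x))\<^sup>2)" for x
    proof -
      have "c\<^sup>2 * (norm x)\<^sup>2 \<le> (norm (T (T x) + (- M\<^sup>2) *\<^sub>R x))\<^sup>2"
        using power_mono[OF c(2)[of x], of 2] c(1) by (simp add: power_mult_distrib)
      also have "\<dots> = (norm (T (T x)))\<^sup>2 - 2 * M\<^sup>2 * (norm (T x))\<^sup>2 + M\<^sup>2 * M\<^sup>2 * (norm x)\<^sup>2"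
        unfolding norm_add_sq
        by (simp add: cinner.minus_right cinner.scaleR_right power_mult_distrib selfadjD[OF T, of "T x"] Re_cinner_self power2_eq_square)
      also have "(norm (T (T x)))\<^sup>2 \<le> M\<^sup>2 * (norm (T x))\<^sup>2"
        using power_mono[OF norm_blinfun[of T "T x"], of 2] by (simp add: M_def power_mult_distrib)
      finally show ?thesis
        by (simp add: algebra_simps)
    qed
    \<comment> \<open>\<open>key\<close> solved for the squared norm of Tx. As \<open>d\<close> is
      strictly below M^2, this contradicts that \<open>M\<close> is the operator norm.\<close>
    define d where "d = M\<^sup>2 - c\<^sup>2 / M\<^sup>2"
    have d: "(norm (T x))\<^sup>2 \<le> d * (norm x)\<^sup>2" for x
      using key[of x] M by (simp add: d_def field_simps power2_eq_square)
    have "d \<ge> 0"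
      using order_trans[OF zero_le_power2 d[of x0]] x0 by (simp add: zero_le_mult_iff)
    have "norm (T x) \<le> sqrt d * norm x" for x
      using real_sqrt_le_mono[OF d[of x]] by (simp add: real_sqrt_mult)
    then have "M \<le> sqrt d"
      unfolding M_def using \<open>d \<ge> 0\<close> by (intro norm_blinfun_bound) auto
    then have "M\<^sup>2 \<le> d"
      using M \<open>d \<ge> 0\<close> by (metis real_sqrt_le_iff real_sqrt_abs abs_of_pos)
    then show False
      using c(1) M by (simp add: d_def field_simps)
  qed
qed

lemma real_spectrum_root:
  fixes P :: "'a::chilbert_space \<Rightarrow>\<^sub>L 'a"
  assumes P: "selfadj P" and x0: "x0 \<noteq> (0 :: 'a)" and u: "\<not> bounded_below (op_poly u P)"
  obtains t where "t \<in> real_spectrum P" "poly u t = 0"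
proof (cases "u = 0")
  case True
  \<comment> \<open>The zero polynomial vanishes everywhere, but a spectral point is still required;
    t^2 - \<open>norm P\<close>^2 is a nonzero polynomial that produces one.\<close>
  define v where "v = [:- (norm P)\<^sup>2, 0, 1:]"
  have "op_poly v P = (P o\<^sub>L P) - (norm P)\<^sup>2 *\<^sub>R id_blinfun"
    by (simp add: v_def op_poly_pCons blinfun_compose_id)
  then have "\<not> bounded_below (op_poly v P)"
    using not_bounded_below_norm[OF P x0] by simp
  moreover have "v \<noteq> 0"
    by (simp add: v_def)
  ultimately obtain t where "t \<in> real_spectrum P"
    using bounded_below_op_poly[OF P] by blast
  then show ?thesis
    using that True by simp
next
  case False
  then show ?thesis
    using bounded_below_op_poly[OF P] u that by blast
qed

lemma norm_op_poly_le:
  fixes P :: "'a::chilbert_space \<Rightarrow>\<^sub>L 'a"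
  assumes P: "selfadj P" and c: "c \<ge> 0" and h: "\<And>t. t \<in> real_spectrum P \<Longrightarrow> \<bar>poly h t\<bar> \<le> c"
  shows "norm (op_poly h P) \<le> c"
proof (rule ccontr)
  define T where "T = op_poly h P"
  assume "\<not> norm (op_poly h P) \<le> c"
  then have T: "norm T > c"
    by (simp add: T_def)
  with c have "T \<noteq> 0"
    by auto
  then obtain x0 :: 'a where x0: "x0 \<noteq> 0"
    by (metis blinfun.zero_right blinfun_eqI zero_blinfun.rep_eq)
  \<comment> \<open>A spectral root of \<open>u\<close> is a point where the absolute value of
    \<open>h\<close> equals \<open>norm T\<close>, hence exceeds \<open>c\<close>.\<close>
  define u where "u = h * h - [:(norm T)\<^sup>2:]"
  have "op_poly u P = (T o\<^sub>L T) - (norm T)\<^sup>2 *\<^sub>R id_blinfun"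
    by (simp add: u_def op_poly_diff op_poly_mult op_poly_pCons T_def)
  then have "\<not> bounded_below (op_poly u P)"
    using not_bounded_below_norm[OF selfadj_op_poly[OF P] x0] by (simp add: T_def)
  then obtain t where t: "t \<in> real_spectrum P" "poly u t = 0"
    using real_spectrum_root[OF P x0] by blast
  then have "\<bar>poly h t\<bar> = norm T"
    by (simp add: u_def flip: power2_eq_square) (metis abs_norm_cancel power2_eq_iff abs_minus abs_minus_cancel)
  then show False
    using h[OF t(1)] T by simp
qed

section \<open>The functional calculus of a positive operator\<close>

text \<open>Stone-Weierstrass with errors 1/(k+1), transferred to the type \<open>poly\<close> over
  which \<open>cfc\<close> quantifies.\<close>

lemma poly_approximation:
  fixes f :: "real \<Rightarrow> real"
  assumes f: "continuous_on {0..M} f"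
  obtains h :: "nat \<Rightarrow> real poly" where "uniform_limit {0..M} (\<lambda>k. poly (h k)) f sequentially"
proof -
  have "\<exists>h. \<forall>x\<in>{0..M}. \<bar>f x - poly h x\<bar> < inverse (real (Suc k))" for k
  proof -
    obtain w where w: "real_polynomial_function w" "\<And>x. x \<in> {0..M} \<Longrightarrow> \<bar>f x - w x\<bar> < inverse (real (Suc k))"
      using Stone_Weierstrass_real_polynomial_function[OF compact_Icc f, of "inverse (real (Suc k))"] by auto
    then obtain a N where "w = (\<lambda>x. \<Sum>i\<le>N. a i * x ^ i)"
      using real_polynomial_function_imp_sum by blast
    then have "w = poly (\<Sum>i\<le>N. monom (a i) i)"
      by (auto simp: poly_sum poly_monom)
    with w(2) show ?thesis by blast
  qed
  then obtain h where h: "\<And>k x. x \<in> {0..M} \<Longrightarrow> \<bar>f x - poly (h k) x\<bar> < inverse (real (Suc k))"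
    by metis
  have "uniform_limit {0..M} (\<lambda>k. poly (h k)) f sequentially"
  proof (rule uniform_limitI)
    fix e :: real assume "e > 0"
    then have "\<forall>\<^sub>F k in sequentially. inverse (real (Suc k)) < e"
      by (rule order_tendstoD(2)[OF LIMSEQ_inverse_real_of_nat])
    then show "\<forall>\<^sub>F k in sequentially. \<forall>x\<in>{0..M}. dist (poly (h k) x) (f x) < e"
      by eventually_elim (auto simp: dist_real_def abs_minus_commute intro: less_trans[OF h])
  qed
  then show ?thesis by (rule that)
qed

text \<open>Two sequences are compared: equal ones give the Cauchy property, different ones the
  independence of the limit from the approximation.\<close>

lemma op_poly_close:
  fixes P :: "'a::chilbert_space \<Rightarrow>\<^sub>L 'a"
  assumes P: "selfadj P" and e: "e > 0"
    and h: "uniform_limit (real_spectrum P) (\<lambda>k. poly (h k)) f sequentially"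
    and h': "uniform_limit (real_spectrum P) (\<lambda>k. poly (h' k)) f sequentially"
  shows "\<exists>N. \<forall>i\<ge>N. \<forall>j\<ge>N. norm (op_poly (h i) P - op_poly (h' j) P) < e"
proof -
  have "e / 4 > 0" using e by simp
  from uniform_limitD[OF h this] uniform_limitD[OF h' this]
  have "\<forall>\<^sub>F k in sequentially. \<forall>t\<in>real_spectrum P. dist (poly (h k) t) (f t) < e / 4 \<and> dist (poly (h' k) t) (f t) < e / 4"
    by eventually_elim simp
  then obtain N where N: "\<And>k t. k \<ge> N \<Longrightarrow> t \<in> real_spectrum P \<Longrightarrow>
      dist (poly (h k) t) (f t) < e / 4 \<and> dist (poly (h' k) t) (f t) < e / 4"
    unfolding eventually_sequentially by blast
  have "norm (op_poly (h i) P - op_poly (h' j) P) < e" if "i \<ge> N" "j \<ge> N" for i j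
  proof -
    have "norm (op_poly (h i - h' j) P) \<le> e / 2"
    proof (rule norm_op_poly_le[OF P])
      show "\<bar>poly (h i - h' j) t\<bar> \<le> e / 2" if t: "t \<in> real_spectrum P" for t
        using N[OF \<open>i \<ge> N\<close> t] N[OF \<open>j \<ge> N\<close> t]
        by (simp only: dist_real_def poly_diff) linarith
    qed (use e in simp)
    then show ?thesis
      using e by (simp add: op_poly_diff)
  qed
  then show ?thesis by blast
qed

text \<open>The interval contains the spectrum. Its endpoint \<open>M\<close> is left free so that
  one polynomial sequence can serve two operators at once.\<close>

lemma cfc_tendsto:
  fixes P :: "'a::chilbert_space \<Rightarrow>\<^sub>L 'a"
  assumes P: "posop P" and M: "norm P \<le> M"
    and h: "uniform_limit {0..M} (\<lambda>k. poly (h k)) f sequentially"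
  shows "(\<lambda>k. op_poly (h k) P) \<longlonglongrightarrow> cfc f P"
proof -
  have sa: "selfadj P"
    using P by (rule posop_selfadj)
  have hs: "uniform_limit (real_spectrum P) (\<lambda>k. poly (h k)) f sequentially"
    using h by (rule uniform_limit_on_subset) (use real_spectrum_subset[OF P] M in auto)
  have "Cauchy (\<lambda>k. op_poly (h k) P)"
    unfolding Cauchy_def dist_norm using op_poly_close[OF sa _ hs hs] by meson
  then obtain T where T: "(\<lambda>k. op_poly (h k) P) \<longlonglongrightarrow> T"
    using Cauchy_convergent_iff convergent_def by blast
  have lim: "(\<lambda>k. op_poly (h' k) P) \<longlonglongrightarrow> T"
    if h': "uniform_limit (real_spectrum P) (\<lambda>k. poly (h' k)) f sequentially" for h'
  proof -
    have "(\<lambda>k. op_poly (h k) P - op_poly (h' k) P) \<longlonglongrightarrow> 0"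
      unfolding LIMSEQ_def dist_norm using op_poly_close[OF sa _ hs h'] by (metis diff_zero)
    from tendsto_diff[OF T this] show ?thesis by simp
  qed
  have "cfc f P = T"
    unfolding cfc_def real_spectrum_def[symmetric]
  proof (rule the_equality)
    \<comment> \<open>The existing sequence \<open>h\<close> keeps the defining implication from
      being vacuous and so pins down the limit.\<close>
    show "S = T" if "\<forall>h. uniform_limit (real_spectrum P) (\<lambda>k. poly (h k)) f sequentially \<longrightarrow>
        (\<lambda>k. op_poly (h k) P) \<longlonglongrightarrow> S" for S
      using that hs T LIMSEQ_unique by blast
  qed (use lim in blast)
  with T show ?thesis by simp
qed

lemma cfc_approximation:
  fixes P :: "'a::chilbert_space \<Rightarrow>\<^sub>L 'a"
  assumes P: "posop P" and f: "continuous_on {0..} f"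
  obtains h where "uniform_limit {0..norm P} (\<lambda>k. poly (h k)) f sequentially"
    "(\<lambda>k. op_poly (h k) P) \<longlonglongrightarrow> cfc f P"
proof -
  have "continuous_on {0..norm P} f"
    using f by (rule continuous_on_subset) auto
  then obtain h where h: "uniform_limit {0..norm P} (\<lambda>k. poly (h k)) f sequentially"
    by (rule poly_approximation)
  show ?thesis
    by (rule that[OF h cfc_tendsto[OF P order_refl h]])
qed

context
  fixes P :: "'a::chilbert_space \<Rightarrow>\<^sub>L 'a"
  assumes P: "posop P"
begin

lemma cfc_poly: "cfc (poly h) P = op_poly h P"
proof -
  have "uniform_limit {0..norm P} (\<lambda>_ :: nat. poly h) (poly h) sequentially"
    by (rule uniform_limit_const)
  from cfc_tendsto[OF P order_refl this] show ?thesis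
    by (simp add: LIMSEQ_const_iff)
qed

text \<open>The spectrum lies in the non-negative reals, so values at negative arguments have no
  influence.\<close>

lemma cfc_cong:
  assumes f: "continuous_on {0..} f" and eq: "\<And>t. t \<ge> 0 \<Longrightarrow> f t = g t"
  shows "cfc f P = cfc g P"
proof -
  obtain h where h: "uniform_limit {0..norm P} (\<lambda>k. poly (h k)) f sequentially"
      "(\<lambda>k. op_poly (h k) P) \<longlonglongrightarrow> cfc f P"
    using cfc_approximation[OF P f] .
  have "uniform_limit {0..norm P} (\<lambda>k. poly (h k)) g sequentially"
    using h(1) by (rule uniform_limit_cong'[THEN iffD1, rotated -1]) (auto simp: eq)
  from cfc_tendsto[OF P order_refl this] h(2) show ?thesis
    using LIMSEQ_unique by blast
qed

lemma cfc_add: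
  assumes f: "continuous_on {0..} f" and g: "continuous_on {0..} g"
  shows "cfc (\<lambda>t. f t + g t) P = cfc f P + cfc g P"
proof -
  obtain h where h: "uniform_limit {0..norm P} (\<lambda>k. poly (h k)) f sequentially"
      "(\<lambda>k. op_poly (h k) P) \<longlonglongrightarrow> cfc f P"
    using cfc_approximation[OF P f] .
  obtain h' where h': "uniform_limit {0..norm P} (\<lambda>k. poly (h' k)) g sequentially"
      "(\<lambda>k. op_poly (h' k) P) \<longlonglongrightarrow> cfc g P"
    using cfc_approximation[OF P g] .
  have "uniform_limit {0..norm P} (\<lambda>k. poly (h k + h' k)) (\<lambda>t. f t + g t) sequentially"
    unfolding poly_add by (intro uniform_limit_add h(1) h'(1))
  from cfc_tendsto[OF P order_refl this]
  have "(\<lambda>k. op_poly (h k) P + op_poly (h' k) P) \<longlonglongrightarrow> cfc (\<lambda>t. f t + g t) P"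
    by (simp add: op_poly_add)
  then show ?thesis
    using LIMSEQ_unique tendsto_add[OF h(2) h'(2)] by blast
qed

lemma cfc_mult:
  assumes f: "continuous_on {0..} f" and g: "continuous_on {0..} g"
  shows "cfc (\<lambda>t. f t * g t) P = cfc f P o\<^sub>L cfc g P"
proof -
  obtain h where h: "uniform_limit {0..norm P} (\<lambda>k. poly (h k)) f sequentially"
      "(\<lambda>k. op_poly (h k) P) \<longlonglongrightarrow> cfc f P"
    using cfc_approximation[OF P f] .
  obtain h' where h': "uniform_limit {0..norm P} (\<lambda>k. poly (h' k)) g sequentially"
      "(\<lambda>k. op_poly (h' k) P) \<longlonglongrightarrow> cfc g P"
    using cfc_approximation[OF P g] .
  \<comment> \<open>Uniform limits multiply only for bounded limit functions; compactness of the
    interval provides this.\<close>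
  have bdd: "bounded (k ` {0..norm P})" if "continuous_on {0..} k" for k :: "real \<Rightarrow> real"
    by (intro compact_imp_bounded compact_continuous_image compact_Icc continuous_on_subset[OF that]) auto
  have "uniform_limit {0..norm P} (\<lambda>k. poly (h k * h' k)) (\<lambda>t. f t * g t) sequentially"
    unfolding poly_mult by (intro uniform_lim_mult h(1) h'(1) bdd f g)
  from cfc_tendsto[OF P order_refl this]
  have "(\<lambda>k. op_poly (h k) P o\<^sub>L op_poly (h' k) P) \<longlonglongrightarrow> cfc (\<lambda>t. f t * g t) P"
    by (simp add: op_poly_mult)
  then show ?thesis
    using LIMSEQ_unique bounded_bilinear.tendsto[OF bounded_bilinear_blinfun_compose h(2) h'(2)] by blast
qed

lemma selfadj_cfc: "continuous_on {0..} f \<Longrightarrow> selfadj (cfc f P)"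
  by (erule cfc_approximation[OF P], erule selfadj_limit, rule selfadj_op_poly[OF posop_selfadj[OF P]])

text \<open>Writing f as the square of g = sqrt f turns the form of f(P) at \<open>x\<close> into
  the squared norm of g(P)x.\<close>

lemma posop_cfc:
  assumes f: "continuous_on {0..} f" and nn: "\<And>t. t \<ge> 0 \<Longrightarrow> f t \<ge> 0"
  shows "posop (cfc f P)"
proof -
  define g where "g t = sqrt (f t)" for t
  have g: "continuous_on {0..} g"
    unfolding g_def by (intro continuous_intros f)
  have "cfc f P = cfc (\<lambda>t. g t * g t) P"
    by (rule cfc_cong[OF f]) (simp add: g_def nn)
  also have "\<dots> = cfc g P o\<^sub>L cfc g P"
    by (rule cfc_mult[OF g g])
  finally have "Re (cinner (cfc f P x) x) = (norm (cfc g P x))\<^sup>2" for x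
    using selfadjD[OF selfadj_cfc[OF g], of "cfc g P x" x] by (simp add: Re_cinner_self)
  then show ?thesis
    by (simp add: posop_def selfadj_cfc[OF f])
qed

lemma norm_cfc_apply:
  assumes f: "continuous_on {0..} f"
  shows "(norm (cfc f P x))\<^sup>2 = Re (cinner (cfc (\<lambda>t. f t * f t) P x) x)"
  using selfadjD[OF selfadj_cfc[OF f], of "cfc f P x" x] by (simp add: cfc_mult[OF f f] Re_cinner_self)

lemma cfc_mono:
  assumes f: "continuous_on {0..} f" and g: "continuous_on {0..} g" and le: "\<And>t. t \<ge> 0 \<Longrightarrow> f t \<le> g t"
  shows "Re (cinner (cfc f P x) x) \<le> Re (cinner (cfc g P x) x)"
proof -
  have d: "continuous_on {0..} (\<lambda>t. g t - f t)"
    by (intro continuous_intros f g)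
  have "cfc g P = cfc (\<lambda>t. f t + (g t - f t)) P"
    by simp
  also have "\<dots> = cfc f P + cfc (\<lambda>t. g t - f t) P"
    by (rule cfc_add[OF f d])
  finally show ?thesis
    using posopD[OF posop_cfc[OF d], of x] le by (simp add: blinfun.add_left cinner_add_left)
qed

lemma cfc_linear: "cfc (\<lambda>t. a + b * t) P = a *\<^sub>R id_blinfun + b *\<^sub>R P"
proof -
  have "poly [:a, b:] = (\<lambda>t. a + b * t)"
    by (simp add: fun_eq_iff)
  then show ?thesis
    using cfc_poly[of "[:a, b:]"] by (simp add: op_poly_linear)
qed

text \<open>Reduces norm estimates for functions of \<open>P\<close> to pointwise ones, by
  monotonicity of the calculus at the squares.\<close>

lemma norm_cfc_apply_mono:
  assumes f: "continuous_on {0..} f" and g: "continuous_on {0..} g" and le: "\<And>t. t \<ge> 0 \<Longrightarrow> \<bar>f t\<bar> \<le> \<bar>g t\<bar>"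
  shows "norm (cfc f P x) \<le> norm (cfc g P x)"
proof (rule power2_le_imp_le)
  show "(norm (cfc f P x))\<^sup>2 \<le> (norm (cfc g P x))\<^sup>2"
    unfolding norm_cfc_apply[OF f] norm_cfc_apply[OF g]
    using abs_le_square_iff[THEN iffD1, OF le]
    by (intro cfc_mono continuous_intros f g) (simp add: power2_eq_square)
qed simp

end

text \<open>With \<open>M\<close> the larger norm, the same polynomials approximate \<open>f\<close>
  on both spectra, and the polynomial identity passes to the limit.\<close>

lemma cfc_intertwine:
  fixes P Q X :: "'a::chilbert_space \<Rightarrow>\<^sub>L 'a"
  assumes P: "posop P" and Q: "posop Q" and f: "continuous_on {0..} f"
    and eq: "X o\<^sub>L P = Q o\<^sub>L X"
  shows "X o\<^sub>L cfc f P = cfc f Q o\<^sub>L X"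
proof -
  define M where "M = max (norm P) (norm Q)"
  have "continuous_on {0..M} f"
    using f by (rule continuous_on_subset) auto
  then obtain h where h: "uniform_limit {0..M} (\<lambda>k. poly (h k)) f sequentially"
    by (rule poly_approximation)
  have "(\<lambda>k. X o\<^sub>L op_poly (h k) P) \<longlonglongrightarrow> (X o\<^sub>L cfc f P)"
    by (intro bounded_bilinear.tendsto[OF bounded_bilinear_blinfun_compose] tendsto_const
        cfc_tendsto[OF P _ h]) (simp add: M_def)
  moreover have "(\<lambda>k. op_poly (h k) Q o\<^sub>L X) \<longlonglongrightarrow> (cfc f Q o\<^sub>L X)"
    by (intro bounded_bilinear.tendsto[OF bounded_bilinear_blinfun_compose] tendsto_const
        cfc_tendsto[OF Q _ h]) (simp add: M_def)
  ultimately show ?thesis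
    using LIMSEQ_unique by (simp add: op_poly_intertwine[OF eq])
qed

section \<open>Operator inequalities\<close>

text \<open>Positivity of \<open>s\<close> matters at 0: by convention \<open>0 powr 0 = 0\<close>,
  which would make the function jump.\<close>

lemma continuous_on_powr_nonneg: "s > 0 \<Longrightarrow> continuous_on {0..} (\<lambda>t :: real. t powr s)"
  by (intro continuous_on_powr' continuous_intros) auto

lemma cinner_adj_left:
  fixes A :: "'a::chilbert_space \<Rightarrow>\<^sub>L 'a"
  assumes "A \<in> bounded_ops"
  shows "cinner (adj A x) y = cinner x (A y)"
  using cinner_adj[OF adj_bounded_ops[OF assms]] by (simp add: adj_adj[OF assms])

text \<open>Both claims follow from one identity: the form at \<open>x\<close> and \<open>y\<close>
  is the inner product of F(Bx) and F(By).\<close>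

lemma
  fixes B F :: "'a::chilbert_space \<Rightarrow>\<^sub>L 'a"
  assumes B: "B \<in> bounded_ops" and F: "selfadj F"
  shows posop_sandwich: "posop (adj B o\<^sub>L op_power F 2 o\<^sub>L B)"
    and cinner_sandwich: "Re (cinner ((adj B o\<^sub>L op_power F 2 o\<^sub>L B) x) x) = (norm (F (B x)))\<^sup>2"
proof -
  have eq: "cinner ((adj B o\<^sub>L op_power F 2 o\<^sub>L B) x) y = cinner (F (B x)) (F (B y))" for x y
    by (simp add: numeral_2_eq_2 cinner_adj_left[OF B] selfadjD[OF F, of "F (B x)"])
  show sq: "Re (cinner ((adj B o\<^sub>L op_power F 2 o\<^sub>L B) x) x) = (norm (F (B x)))\<^sup>2" for x
    unfolding eq by (rule Re_cinner_self)
  have "op_power F 2 = F o\<^sub>L F"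
    by (simp add: numeral_2_eq_2 blinfun_compose_id)
  then have "adj B o\<^sub>L op_power F 2 o\<^sub>L B \<in> bounded_ops"
    by (simp add: bounded_ops_compose adj_bounded_ops B selfadj_bounded_ops[OF F])
  moreover have "cinner ((adj B o\<^sub>L op_power F 2 o\<^sub>L B) x) y = cinner x ((adj B o\<^sub>L op_power F 2 o\<^sub>L B) y)" for x y
    by (metis eq cinner_commute)
  ultimately show "posop (adj B o\<^sub>L op_power F 2 o\<^sub>L B)"
    using sq by (simp add: posop_def selfadj_def)
qed

lemma posop_sum: "(\<And>i. i \<in> I \<Longrightarrow> posop (P i)) \<Longrightarrow> posop (sum P I)"
  by (auto simp: posop_def blinfun.sum_left cinner.sum_left intro!: selfadj_sum sum_nonneg)

lemma posop_adj_compose: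
  fixes X :: "'a::chilbert_space \<Rightarrow>\<^sub>L 'a"
  assumes X: "X \<in> bounded_ops"
  shows "posop (adj X o\<^sub>L X)"
  using posop_sandwich[OF X selfadj_id] by (simp add: numeral_2_eq_2 blinfun_compose_id)

section \<open>The absolute value and the mixed Schwarz inequality\<close>

context
  fixes X :: "'a::chilbert_space \<Rightarrow>\<^sub>L 'a"
  assumes X: "X \<in> bounded_ops"
begin

lemma posop_op_abs: "posop (op_abs X)"
  unfolding op_abs_def op_powr_def
  by (intro posop_cfc posop_adj_compose X continuous_on_powr_nonneg) auto

text \<open>The square of \<open>op_abs X\<close> is \<open>adj X o\<^sub>L X\<close>. This isometry
  takes the place of the polar decomposition below.\<close>

lemma norm_op_abs_apply: "norm (op_abs X x) = norm (X x)"
proof -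
  have c: "continuous_on {0..} (\<lambda>t :: real. t powr (1/2))"
    by (rule continuous_on_powr_nonneg) simp
  have "cfc (\<lambda>t. t powr (1/2) * t powr (1/2)) (adj X o\<^sub>L X) = cfc (\<lambda>t. 0 + 1 * t) (adj X o\<^sub>L X)"
    by (rule cfc_cong[OF posop_adj_compose[OF X]])
       (auto intro!: continuous_intros c simp flip: powr_add)
  also have "\<dots> = adj X o\<^sub>L X"
    by (subst cfc_linear[OF posop_adj_compose[OF X]]) simp
  finally have "(norm (op_abs X x))\<^sup>2 = Re (cinner ((adj X o\<^sub>L X) x) x)"
    unfolding op_abs_def op_powr_def by (subst norm_cfc_apply[OF posop_adj_compose[OF X] c]) simp
  also have "\<dots> = (norm (X x))\<^sup>2"
    by (simp add: cinner_adj_left[OF X] Re_cinner_self)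
  finally show ?thesis
    by (simp add: power2_eq_iff_nonneg)
qed

text \<open>\<open>X\<close> intertwines \<open>adj X o\<^sub>L X\<close> with
  \<open>X o\<^sub>L adj X\<close> by associativity, hence also their square roots.\<close>

lemma op_abs_intertwine: "X o\<^sub>L op_abs X = op_abs (adj X) o\<^sub>L X"
  unfolding op_abs_def op_powr_def
  by (intro cfc_intertwine posop_adj_compose X adj_bounded_ops continuous_on_powr_nonneg)
     (simp_all add: adj_adj[OF X] blinfun_compose_assoc)

end

text \<open>Kittaneh's mixed Schwarz inequality. Instead of a polar decomposition, write
  \<open>X = X|X|(|X| + e)\<^sup>-\<^sup>1 + O(e)\<close> and use \<open>X g(|X|) = g(|X\<^sup>*|) X\<close> to obtain
  \<open>X|X|(|X| + e)\<^sup>-\<^sup>1 = g(|X\<^sup>*|) X(|X| + e)\<^sup>-\<^sup>1 f(|X|)\<close>.\<close>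

lemma mixed_Schwarz:
  fixes X :: "'a::chilbert_space \<Rightarrow>\<^sub>L 'a"
  assumes X: "X \<in> bounded_ops"
    and f: "continuous_on {0..} f" and g: "continuous_on {0..} g"
    and fg: "\<And>t. t \<ge> 0 \<Longrightarrow> f t * g t = t"
  shows "cmod (cinner (X a) b) \<le> norm (cfc f (op_abs X) a) * norm (cfc g (op_abs (adj X)) b)"
proof -
  define P F G where "P = op_abs X" and "F = cfc f P" and "G = cfc g (op_abs (adj X))"
  have P: "posop P"
    unfolding P_def by (rule posop_op_abs[OF X])
  have Q: "posop (op_abs (adj X))"
    by (rule posop_op_abs[OF adj_bounded_ops[OF X]])
  have normP: "norm (X y) = norm (P y)" for y
    by (simp add: P_def norm_op_abs_apply[OF X])
  have id: "continuous_on {0..} (\<lambda>t :: real. t)" "cfc (\<lambda>t. t) P = P"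
    using cfc_linear[OF P, of 0 1] by simp_all
  have const: "cfc (\<lambda>t. c) P y = c *\<^sub>R y" for c y
    using cfc_linear[OF P, of c 0] by (simp add: blinfun.scaleR_left)
  have main: "cmod (cinner (X a) b) \<le> norm (F a) * norm (G b) + e * (norm a * norm b)" if e: "e > 0" for e
  proof -
    \<comment> \<open>A regularised inverse of \<open>P\<close>; the remainder \<open>k'\<close>
      below equals e/(t + e) for t \<ge> 0.\<close>
    define k where "k t = 1 / (t + e)" for t
    have k: "continuous_on {0..} k"
      unfolding k_def using e by (intro continuous_intros) auto
    define k' where "k' t = 1 - t * k t" for t
    have tk: "continuous_on {0..} (\<lambda>t. t * k t)" and k': "continuous_on {0..} k'"
      unfolding k'_def by (intro continuous_intros k)+
    have "cfc (\<lambda>t. t * k t) P = cfc (\<lambda>t. g t * (k t * f t)) P"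
      by (rule cfc_cong[OF P tk]) (use fg in \<open>metis mult.commute mult.assoc\<close>)
    also have "\<dots> = cfc g P o\<^sub>L (cfc k P o\<^sub>L F)"
      by (simp add: cfc_mult[OF P] f g k continuous_on_mult F_def)
    finally have "X (cfc (\<lambda>t. t * k t) P a) = (X o\<^sub>L cfc g P) (cfc k P (F a))"
      by simp
    also have "X o\<^sub>L cfc g P = G o\<^sub>L X"
      unfolding G_def by (rule cfc_intertwine[OF P Q g]) (simp add: P_def op_abs_intertwine[OF X])
    finally have XG: "X (cfc (\<lambda>t. t * k t) P a) = G (X (cfc k P (F a)))"
      by simp
    \<comment> \<open>Replacing \<open>X\<close> by \<open>P\<close> under the norm leaves the
      function t/(t + e), which is at most 1.\<close>
    have "norm (X (cfc k P (F a))) = norm (cfc (\<lambda>t. t * k t) P (F a))"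
      by (simp add: normP cfc_mult[OF P] id k)
    also have "\<dots> \<le> norm (cfc (\<lambda>t. 1) P (F a))"
      by (rule norm_cfc_apply_mono[OF P tk]) (use e in \<open>auto simp: k_def\<close>)
    finally have 1: "norm (X (cfc k P (F a))) \<le> norm (F a)"
      by (simp add: const)
    have "norm (X (cfc k' P a)) = norm (cfc (\<lambda>t. t * k' t) P a)"
      by (simp add: normP cfc_mult[OF P] id k')
    also have "\<dots> \<le> norm (cfc (\<lambda>t. e) P a)"
    proof (rule norm_cfc_apply_mono[OF P])
      fix t :: real assume t: "t \<ge> 0"
      have "t * k' t = e * (t / (t + e))"
        using t e by (simp add: k'_def k_def field_simps add_nonneg_eq_0_iff)
      moreover have "0 \<le> t / (t + e)" "t / (t + e) \<le> 1"
        using t e by simp_all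
      ultimately have "0 \<le> t * k' t" "t * k' t \<le> e"
        using e by (simp_all only: mult_nonneg_nonneg less_imp_le mult_left_le)
      then show "\<bar>t * k' t\<bar> \<le> \<bar>e\<bar>"
        by simp
    qed (intro continuous_intros k')+
    finally have 2: "norm (X (cfc k' P a)) \<le> e * norm a"
      using e by (simp add: const)
    have "cfc (\<lambda>t. t * k t + k' t) P = cfc (\<lambda>t. t * k t) P + cfc k' P"
      by (rule cfc_add[OF P tk k'])
    then have "a = cfc (\<lambda>t. t * k t) P a + cfc k' P a"
      using const[of 1 a] by (simp add: k'_def blinfun.add_left)
    then have "X a = G (X (cfc k P (F a))) + X (cfc k' P a)"
      by (metis XG blinfun.add_right)
    then have "cinner (X a) b = cinner (X (cfc k P (F a))) (G b) + cinner (X (cfc k' P a)) b"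
      using selfadjD[OF selfadj_cfc[OF Q g]] by (simp add: cinner_add_left G_def)
    then have "cmod (cinner (X a) b) \<le> cmod (cinner (X (cfc k P (F a))) (G b)) + cmod (cinner (X (cfc k' P a)) b)"
      by (simp add: norm_triangle_ineq)
    also have "\<dots> \<le> norm (F a) * norm (G b) + (e * norm a) * norm b"
      by (intro add_mono order_trans[OF cmod_cinner_le] mult_right_mono 1 2 norm_ge_zero)
    finally show ?thesis
      by (simp add: mult.assoc)
  qed
  show ?thesis
    unfolding P_def[symmetric] F_def[symmetric] G_def[symmetric]
  proof (rule field_le_epsilon)
    fix d :: real assume d: "d > 0"
    \<comment> \<open>The choice e = d/(c + 1) keeps the error e c below d, also for c = 0.\<close>
    define c where "c = norm a * norm b"
    have c: "c \<ge> 0"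
      by (simp add: c_def)
    have "d / (c + 1) * c \<le> d"
      using c d by (simp add: field_simps)
    then show "cmod (cinner (X a) b) \<le> norm (F a) * norm (G b) + d"
      using main[of "d / (c + 1)"] c d unfolding c_def[symmetric] by fastforce
  qed
qed

text \<open>Young's inequality for \<open>t\<close> and \<open>l powr (s - 1)\<close> with exponents
  s and s/(s - 1). The case s = 1, where the conjugate exponent is infinite, is linear.\<close>

lemma powr_above_tangent:
  fixes t l s :: real
  assumes t: "t \<ge> 0" and l: "l > 0" and s: "s \<ge> 1"
  shows "l powr s + s * l powr (s - 1) * (t - l) \<le> t powr s"
proof (cases "s = 1")
  case False
  with s have s: "s > 1" by simp
  have "t * l powr (s - 1) \<le> t powr s / s + (l powr (s - 1)) powr (s / (s - 1)) / (s / (s - 1))"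
    by (rule Youngs_inequality) (use s t in \<open>auto simp: field_simps\<close>)
  also have "(l powr (s - 1)) powr (s / (s - 1)) = l powr s"
    using s by (simp add: powr_powr)
  finally have "s * (t * l powr (s - 1)) \<le> t powr s + (s - 1) * l powr s"
    using s by (simp add: field_simps)
  moreover have "l powr (s - 1) * l = l powr s"
    using l by (simp add: powr_diff)
  ultimately show ?thesis
    by (simp add: algebra_simps)
qed (use t l in simp)

text \<open>Jensen's argument: the tangent of the power function at the mean \<open>l\<close> lies
  below it, and the calculus preserves this order. If \<open>l = 0\<close> the left side is
  0.\<close>

lemma Hoelder_McCarthy:
  fixes P :: "'a::chilbert_space \<Rightarrow>\<^sub>L 'a"
  assumes P: "posop P" and s: "s \<ge> 1" and x: "norm x = 1"
  shows "Re (cinner (P x) x) powr s \<le> Re (cinner (op_powr P s x) x)"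
proof -
  define l where "l = Re (cinner (P x) x)"
  have c: "continuous_on {0..} (\<lambda>t :: real. t powr s)"
    using s by (intro continuous_on_powr_nonneg) simp
  show ?thesis
  proof (cases "l = 0")
    case True
    then show ?thesis
      using posopD[OF posop_cfc[OF P c]] by (simp add: l_def op_powr_def)
  next
    case False
    then have l: "l > 0"
      using posopD[OF P, of x] by (simp add: l_def)
    define m where "m = s * l powr (s - 1)"
    \<comment> \<open>At a unit vector an affine function of \<open>P\<close> has as its mean its
      own value at \<open>l\<close>.\<close>
    have "l powr s = Re (cinner (cfc (\<lambda>t. (l powr s - m * l) + m * t) P x) x)"
      using x by (subst cfc_linear[OF P])
        (simp add: blinfun.bilinear_simps cinner_add_left cinner.scaleR_left Re_cinner_self l_def)
    also have "\<dots> \<le> Re (cinner (cfc (\<lambda>t. t powr s) P x) x)"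
    proof (rule cfc_mono[OF P _ c])
      show "(l powr s - m * l) + m * t \<le> t powr s" if "t \<ge> 0" for t
        using powr_above_tangent[OF that l s] by (simp add: m_def algebra_simps)
    qed (intro continuous_intros)
    finally show ?thesis
      by (simp add: l_def op_powr_def)
  qed
qed

section \<open>The numerical radius and the final estimate\<close>

lemma cmod_cinner_le_numerical_radius:
  fixes T :: "'a::chilbert_space \<Rightarrow>\<^sub>L 'a"
  assumes x: "norm x = 1"
  shows "cmod (cinner (T x) x) \<le> numerical_radius T"
proof -
  have "cmod (cinner (T y) y) \<le> norm T" if "norm y = 1" for y
    using order_trans[OF cmod_cinner_le[of "T y" y] mult_right_mono[OF norm_blinfun norm_ge_zero]] that by simp
  then have "bdd_above ((\<lambda>y. cmod (cinner (T y) y)) ` {y. norm y = 1})"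
    by (intro bdd_aboveI2) auto
  then have "cmod (cinner (T x) x) \<le> (SUP y\<in>{y. norm y = 1}. cmod (cinner (T y) y))"
    by (rule cSUP_upper[rotated]) (use x in simp)
  then show ?thesis
    using x by (auto simp: numerical_radius_def)
qed

lemma numerical_radius_nonneg: "0 \<le> numerical_radius T"
proof (cases "\<exists>x :: 'a::chilbert_space. norm x = 1")
  case True
  then show ?thesis
    using cmod_cinner_le_numerical_radius[of _ T] norm_ge_zero order_trans by blast
next
  case False
  then show ?thesis by (simp add: numerical_radius_def)
qed

text \<open>Take r-th roots pointwise, pass to the supremum and raise to the power \<open>r\<close>
  again. On the zero space the left side is 0 and \<open>N \<ge> 0\<close> decides.\<close>

lemma numerical_radius_powr_le:
  fixes T :: "'a::chilbert_space \<Rightarrow>\<^sub>L 'a"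
  assumes r: "r > 0" and N: "N \<ge> 0"
    and le: "\<And>x. norm x = 1 \<Longrightarrow> cmod (cinner (T x) x) powr r \<le> N"
  shows "numerical_radius T powr r \<le> N"
proof (cases "\<exists>x :: 'a. norm x = 1")
  case True
  have "cmod (cinner (T x) x) \<le> N powr (1 / r)" if "norm x = 1" for x
    using powr_mono2[OF _ _ le[OF that], of "1 / r"] r by (simp add: powr_powr)
  then have "numerical_radius T \<le> N powr (1 / r)"
    unfolding numerical_radius_def using True by (auto intro!: cSUP_least)
  then have "numerical_radius T powr r \<le> (N powr (1 / r)) powr r"
    using r by (intro powr_mono2 numerical_radius_nonneg) auto
  then show ?thesis
    using r N by (simp add: powr_powr)
next
  case False
  then show ?thesis
    using N by (simp add: numerical_radius_def)
qed

theorem theorem3p41: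
  fixes A B X :: "nat \<Rightarrow> ('a::chilbert_space \<Rightarrow>\<^sub>L 'a)"
    and n :: nat
    and f g :: "real \<Rightarrow> real"
    and p q r :: real
  assumes "\<forall>i\<in>{1..n}. A i \<in> bounded_ops \<and> B i \<in> bounded_ops \<and> X i \<in> bounded_ops"
    and "continuous_on {0..} f" and "continuous_on {0..} g"
    and "\<forall>t\<ge>0. f t \<ge> 0" and "\<forall>t\<ge>0. g t \<ge> 0"
    and "\<forall>t\<ge>0. f t * g t = t"
    and "r \<ge> 1" and "1 / p + 1 / q = 1" and "p * r \<ge> 2" and "q * r \<ge> 2"
  shows "numerical_radius (\<Sum>i=1..n. adj (A i) o\<^sub>L X i o\<^sub>L B i) powr r
    \<le> numerical_radius
        ((1 / p) *\<^sub>R op_powr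
            (\<Sum>i=1..n. adj (B i) o\<^sub>L op_power (cfc f (op_abs (X i))) 2 o\<^sub>L B i) (p * r / 2)
         + (1 / q) *\<^sub>R op_powr
            (\<Sum>i=1..n. adj (A i) o\<^sub>L op_power (cfc g (op_abs (adj (X i)))) 2 o\<^sub>L A i) (q * r / 2))"
proof (rule numerical_radius_powr_le)
  have AB: "A i \<in> bounded_ops" "B i \<in> bounded_ops" "X i \<in> bounded_ops" if "i \<in> {1..n}" for i
    using assms(1) that by auto
  \<comment> \<open>Positivity comes from pr, qr \<ge> 2 and r \<ge> 1; then both reciprocals are
    positive with sum 1, so both exponents exceed 1.\<close>
  have "p > 0" "q > 0"
    by (rule zero_less_mult_pos2[where a = r]; use assms(7,9,10) in linarith)+
  then have "1 / p > 0" "1 / q > 0"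
    by simp_all
  then have "1 / p < 1" "1 / q < 1"
    using assms(8) by linarith+
  then have pq: "p > 1" "q > 1"
    using \<open>p > 0\<close> \<open>q > 0\<close> by simp_all
  define F where "F i = cfc f (op_abs (X i))" for i
  define G where "G i = cfc g (op_abs (adj (X i)))" for i
  have F: "selfadj (F i)" and G: "selfadj (G i)" if "i \<in> {1..n}" for i
    unfolding F_def G_def
    by (intro selfadj_cfc posop_op_abs adj_bounded_ops AB(3)[OF that] assms(2,3))+
  define S where "S = (\<Sum>i=1..n. adj (B i) o\<^sub>L op_power (F i) 2 o\<^sub>L B i)"
  define T where "T = (\<Sum>i=1..n. adj (A i) o\<^sub>L op_power (G i) 2 o\<^sub>L A i)"
  define R where "R = (1 / p) *\<^sub>R op_powr S (p * r / 2) + (1 / q) *\<^sub>R op_powr T (q * r / 2)"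
  have R_eq: "(1 / p) *\<^sub>R op_powr
            (\<Sum>i=1..n. adj (B i) o\<^sub>L op_power (cfc f (op_abs (X i))) 2 o\<^sub>L B i) (p * r / 2)
         + (1 / q) *\<^sub>R op_powr
            (\<Sum>i=1..n. adj (A i) o\<^sub>L op_power (cfc g (op_abs (adj (X i)))) 2 o\<^sub>L A i) (q * r / 2) = R"
    by (simp add: R_def S_def T_def F_def G_def)
  have S: "posop S" and T: "posop T"
    unfolding S_def T_def by (intro posop_sum posop_sandwich AB F G; assumption)+
  show "0 \<le> numerical_radius ((1 / p) *\<^sub>R op_powr
            (\<Sum>i=1..n. adj (B i) o\<^sub>L op_power (cfc f (op_abs (X i))) 2 o\<^sub>L B i) (p * r / 2)
         + (1 / q) *\<^sub>R op_powr
            (\<Sum>i=1..n. adj (A i) o\<^sub>L op_power (cfc g (op_abs (adj (X i)))) 2 o\<^sub>L A i) (q * r / 2))"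
    by (rule numerical_radius_nonneg)
  fix x :: 'a assume x: "norm x = 1"
  define u where "u i = norm (F i (B i x))" for i
  define v where "v i = norm (G i (A i x))" for i
  define \<alpha> where "\<alpha> = (\<Sum>i=1..n. (u i)\<^sup>2)"
  define \<beta> where "\<beta> = (\<Sum>i=1..n. (v i)\<^sup>2)"
  have \<alpha>: "\<alpha> = Re (cinner (S x) x)" and \<beta>: "\<beta> = Re (cinner (T x) x)"
    unfolding \<alpha>_def \<beta>_def u_def v_def S_def T_def
    by (simp_all only: blinfun.sum_left cinner.sum_left Re_sum)
       (intro sum.cong refl cinner_sandwich[OF AB(2) F, symmetric]
         cinner_sandwich[OF AB(1) G, symmetric]; assumption)+
  have nn: "\<alpha> \<ge> 0" "\<beta> \<ge> 0"
    by (auto simp: \<alpha>_def \<beta>_def intro: sum_nonneg)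
  have "cmod (cinner ((\<Sum>i=1..n. adj (A i) o\<^sub>L X i o\<^sub>L B i) x) x)
      \<le> (\<Sum>i=1..n. cmod (cinner (X i (B i x)) (A i x)))"
    unfolding blinfun.sum_left cinner.sum_left
    by (rule sum_norm_le) (simp add: cinner_adj_left AB)
  also have "\<dots> \<le> (\<Sum>i=1..n. u i * v i)"
    unfolding u_def v_def F_def G_def
    using assms(2,3,6) AB(3) by (intro sum_mono mixed_Schwarz) auto
  also have "\<dots> \<le> sqrt \<alpha> * sqrt \<beta>"
    using Cauchy_Schwarz_ineq_sum[of u v "{1..n}"]
    by (simp add: \<alpha>_def \<beta>_def real_le_rsqrt flip: real_sqrt_mult)
  finally have "cmod (cinner ((\<Sum>i=1..n. adj (A i) o\<^sub>L X i o\<^sub>L B i) x) x) powr r \<le> (sqrt \<alpha> * sqrt \<beta>) powr r"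
    using assms(7) by (intro powr_mono2) auto
  also have "\<dots> = \<alpha> powr (r / 2) * \<beta> powr (r / 2)"
    using nn by (simp add: powr_mult powr_half_sqrt[symmetric] powr_powr)
  also have "\<dots> \<le> (\<alpha> powr (r / 2)) powr p / p + (\<beta> powr (r / 2)) powr q / q"
    by (intro Youngs_inequality pq assms(8)) auto
  also have "\<dots> = (1 / p) * \<alpha> powr (p * r / 2) + (1 / q) * \<beta> powr (q * r / 2)"
    by (simp add: powr_powr mult_ac)
  \<comment> \<open>Here pr, qr \<ge> 2 enter: the exponents pr/2 and qr/2 are at least 1.\<close>
  also have "\<dots> \<le> (1 / p) * Re (cinner (op_powr S (p * r / 2) x) x) + (1 / q) * Re (cinner (op_powr T (q * r / 2) x) x)"
    unfolding \<alpha> \<beta> using pq assms(9,10)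
    by (intro add_mono mult_left_mono Hoelder_McCarthy S T x) auto
  also have "\<dots> = Re (cinner (R x) x)"
    by (simp add: R_def blinfun.bilinear_simps cinner_add_left cinner.scaleR_left)
  also have "\<dots> \<le> cmod (cinner (R x) x)"
    by (rule complex_Re_le_cmod)
  also have "\<dots> \<le> numerical_radius R"
    by (rule cmod_cinner_le_numerical_radius[OF x])
  finally show "cmod (cinner ((\<Sum>i=1..n. adj (A i) o\<^sub>L X i o\<^sub>L B i) x) x) powr r
      \<le> numerical_radius ((1 / p) *\<^sub>R op_powr
            (\<Sum>i=1..n. adj (B i) o\<^sub>L op_power (cfc f (op_abs (X i))) 2 o\<^sub>L B i) (p * r / 2)
         + (1 / q) *\<^sub>R op_powr
            (\<Sum>i=1..n. adj (A i) o\<^sub>L op_power (cfc g (op_abs (adj (X i)))) 2 o\<^sub>L A i) (q * r / 2))"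
    unfolding R_eq .
qed (use assms(7) in simp)

end
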